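(* Let $(A,\mathscr{A},\mu)$ be a semi-finite measure space and let $\mathscr{F}\subset\mathscr{A}$ be a sub-$\sigma$-algebra such that the restricted measure space $(A,\mathscr{F},\mu|_{\mathscr{F}})$ is Maharam. For every Banach space $Y$ the conditional expectation operator $\mathbb{E}^{\infty}_{\mathscr{F},Y}$ on $L^{\infty}(A;Y)$ exists; that is, there is an operator $\mathbb{E}^{\infty}_{\mathscr{F},Y}\in\mathcal{L}(L^{\infty}(A;Y))$ which assigns to each $f\in L^{\infty}(A;Y)$ the unique element $\mathbb{E}^{\infty}_{\mathscr{F},Y}f\in L^{\infty}(A,\mathscr{F};Y)$ satisfying \[ \int_{F}f\,d\mu=\int_{F}\mathbb{E}^{\infty}_{\mathscr{F},Y}f\,d\mu\quad\text{for all } F\in\mathscr{F}\text{ with }\mu(F)<\infty. \] $\mathbb{E}^{\infty}_{\mathscr{F},Y}$ is a contractive projection on $L^{\infty}(A;Y)$ with range $L^{\infty}(A,\mathscr{F};Y)$. Moreover, if $\langle X,Y\rangle$ is a Banach dual pair, then \[ \int_A \langle f,\mathbb{E}_{\mathscr{F},Y}^{\infty}g\rangle\,d\mu = \int_A \langle\mathbb{E}_{\mathscr{F},X}^{1}f,g\rangle\,d\mu \quad\text{for all } f \in L^{1}(A;X),\ g \in L^{\infty}(A;Y). \]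
   Context: All spaces are over a fixed field $\mathbb{K}\in\{\mathbb{R},\mathbb{C}\}$. A measure space is semi-finite if every measurable set of positive measure contains a measurable subset of finite positive measure. It is Maharam (localizable) if it is semi-finite and for every subfamily $\mathscr{E}$ of its $\sigma$-algebra there is a measurable $H$ such that (i) $E\setminus H$ is negligible for every $E\in\mathscr{E}$ and (ii) if $G$ is measurable and $E\setminus G$ is negligible for every $E\in\mathscr{E}$, then $H\setminus G$ is negligible. $L^{p}(A;Y)$ is the Lebesgue-Bochner space of a.e. classes of strongly measurable functions $f:A\to Y$ with $\|f\|_Y\in L^p(A)$, and $L^{p}(A,\mathscr{F};Y)$ is the closed subspace of classes having a strongly $\mathscr{F}$-measurable representative. For a Banach space $X$, $\mathbb{E}^{1}_{\mathscr{F},X}\in\mathcal{L}(L^{1}(A;X))$ is the conditional expectation operator on $L^{1}(A;X)$ (taken as known): it assigns to $f\in L^{1}(A;X)$ the unique $\mathbb{E}^{1}_{\mathscr{F},X}f\in L^{1}(A,\mathscr{F};X)$ with $\int_{F}f\,d\mu=\int_{F}\mathbb{E}^{1}_{\mathscr{F},X}f\,d\mu$ for all $F\in\mathscr{F}$; it is a contractive projection with range $L^1(A,\mathscr F;X)$ and is the bounded extension of $\mathbb{E}^{1}_{\mathscr{F}}\otimes I_X$, where $\mathbb{E}^{1}_{\mathscr{F}}=\mathbb{E}^{1}_{\mathscr{F},\mathbb{K}}$. A Banach dual pair $\langle X,Y\rangle$ consists of Banach spaces $X,Y$ and a bounded bilinear form $\langle\cdot,\cdot\rangle:X\times Y\to\mathbb{K}$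 for which the induced maps $X\to Y^{*}$ and $Y\to X^{*}$ are injective. *)

theory Defs
  imports "HOL-Probability.Probability"
begin

section \<open>Measure spaces\<close>

text \<open>The locale \<open>semifinite_measure\<close> of HOL-Analysis does not ask the finite subset to have
  positive measure, so that the empty set always satisfies it. It cannot be used here.\<close>

definition semi_finite :: "'a measure \<Rightarrow> bool" where
  "semi_finite M \<longleftrightarrow>
    (\<forall>B\<in>sets M. 0 < emeasure M B \<longrightarrow>
      (\<exists>C\<in>sets M. C \<subseteq> B \<and> 0 < emeasure M C \<and> emeasure M C < \<infinity>))"

definition maharam :: "'a measure \<Rightarrow> bool" where
  "maharam M \<longleftrightarrow> semi_finite M \<and>
    (\<forall>\<E>. \<E> \<subseteq> sets M \<longrightarrow>
      (\<exists>H\<in>sets M.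
        (\<forall>B\<in>\<E>. B - H \<in> null_sets M) \<and>
        (\<forall>G\<in>sets M. (\<forall>B\<in>\<E>. B - G \<in> null_sets M) \<longrightarrow> H - G \<in> null_sets M)))"

section \<open>Banach spaces over the real or complex field\<close>

text \<open>The scalar field is a type \<open>'k\<close> of sort \<open>{real_normed_field, euclidean_space}\<close>. Both
  \<open>real\<close> and \<open>complex\<close> are such types, and up to isometric isomorphism they are the only ones
  (Frobenius). The norm, the topology and the underlying real vector space of a Banach space over
  \<open>'k\<close> come from the class \<open>banach\<close>; \<open>smul\<close> is the multiplication by elements of \<open>'k\<close>.\<close>

locale banach_over = vector_space smul
  for smul :: "'k::{real_normed_field,euclidean_space} \<Rightarrow> 'y::banach \<Rightarrow> 'y" +
  assumes smul_of_real: "smul (of_real r) y = r *\<^sub>R y"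
    and norm_smul: "norm (smul c y) = norm c * norm y"

definition banach_dual_pair ::
  "('k::{real_normed_field,euclidean_space} \<Rightarrow> 'x::banach \<Rightarrow> 'x) \<Rightarrow> ('k \<Rightarrow> 'y::banach \<Rightarrow> 'y) \<Rightarrow>
    ('x \<Rightarrow> 'y \<Rightarrow> 'k) \<Rightarrow> bool" where
  "banach_dual_pair smulX smulY pair \<longleftrightarrow>
    banach_over smulX \<and> banach_over smulY \<and>
    bounded_bilinear pair \<and>
    (\<forall>c x y. pair (smulX c x) y = c * pair x y) \<and>
    (\<forall>c x y. pair x (smulY c y) = c * pair x y) \<and>
    inj (\<lambda>x. \<lambda>y. pair x y) \<and>
    inj (\<lambda>y. \<lambda>x. pair x y)"

section \<open>The Bochner integral in arbitrary Banach spaces\<close>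

text \<open>The Bochner integral of HOL-Analysis is restricted to second countable spaces. The following
  definitions remove this restriction, Borel measurability being replaced by strong measurability.\<close>

definition strongly_measurable :: "'a measure \<Rightarrow> ('a \<Rightarrow> 'y::real_normed_vector) \<Rightarrow> bool" where
  "strongly_measurable M f \<longleftrightarrow>
    (\<exists>s. (\<forall>i::nat. simple_function M (s i)) \<and> (\<forall>x\<in>space M. (\<lambda>i. s i x) \<longlonglongrightarrow> f x))"

definition has_strong_integral ::
  "'a measure \<Rightarrow> ('a \<Rightarrow> 'y::real_normed_vector) \<Rightarrow> 'y \<Rightarrow> bool" where
  "has_strong_integral M f I \<longleftrightarrow> strongly_measurable M f \<and>
    (\<exists>s. (\<forall>i::nat. Bochner_Integration.simple_bochner_integrable M (s i)) \<and>
      (\<lambda>i. \<integral>\<^sup>+ x. ennreal (norm (f x - s i x)) \<partial>M) \<longlonglongrightarrow> 0 \<and>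
      (\<lambda>i. Bochner_Integration.simple_bochner_integral M (s i)) \<longlonglongrightarrow> I)"

definition strong_integral :: "'a measure \<Rightarrow> ('a \<Rightarrow> 'y::real_normed_vector) \<Rightarrow> 'y" where
  "strong_integral M f =
    (if \<exists>I. has_strong_integral M f I then THE I. has_strong_integral M f I else 0)"

lemma strongly_measurable_iff_borel_measurable:
  fixes f :: "'a \<Rightarrow> 'y::{real_normed_vector,second_countable_topology}"
  shows "strongly_measurable M f \<longleftrightarrow> f \<in> borel_measurable M"
proof
  assume "strongly_measurable M f"
  then obtain s where s: "\<And>i::nat. simple_function M (s i)"
    "\<And>x. x \<in> space M \<Longrightarrow> (\<lambda>i. s i x) \<longlonglongrightarrow> f x"
    unfolding strongly_measurable_def by blast
  show "f \<in> borel_measurable M"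
    by (rule borel_measurable_LIMSEQ_metric[of s])
      (auto intro: s borel_measurable_simple_function)
next
  assume "f \<in> borel_measurable M"
  then show "strongly_measurable M f"
    using borel_measurable_implies_sequence_metric[of f M 0]
    unfolding strongly_measurable_def by blast
qed

lemma has_strong_integral_iff_has_bochner_integral:
  fixes f :: "'a \<Rightarrow> 'y::{real_normed_vector,second_countable_topology}"
  shows "has_strong_integral M f I \<longleftrightarrow> has_bochner_integral M f I"
  unfolding has_strong_integral_def has_bochner_integral.simps
    strongly_measurable_iff_borel_measurable by blast

section \<open>Lebesgue-Bochner spaces\<close>

definition Lp_norm :: "ennreal \<Rightarrow> 'a measure \<Rightarrow> ('a \<Rightarrow> 'y::real_normed_vector) \<Rightarrow> ennreal" where
  "Lp_norm p M f =
    (if p = \<infinity> then esssup M (\<lambda>x. ennreal (norm (f x)))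
     else let I = \<integral>\<^sup>+ x. ennreal (norm (f x) powr enn2real p) \<partial>M
          in if I = \<infinity> then \<infinity> else ennreal (enn2real I powr (1 / enn2real p)))"

definition ae_class :: "'a measure \<Rightarrow> ('a \<Rightarrow> 'y::real_normed_vector) \<Rightarrow> ('a \<Rightarrow> 'y) set" where
  "ae_class M f = {g. strongly_measurable M g \<and> (AE x in M. g x = f x)}"

definition Lp :: "ennreal \<Rightarrow> 'a measure \<Rightarrow> ('a \<Rightarrow> 'y::real_normed_vector) set set" where
  "Lp p M = ae_class M ` {f. strongly_measurable M f \<and> Lp_norm p M f < \<infinity>}"

definition Lp_sub ::
  "ennreal \<Rightarrow> 'a measure \<Rightarrow> 'a measure \<Rightarrow> ('a \<Rightarrow> 'y::real_normed_vector) set set" where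
  "Lp_sub p M F = {u \<in> Lp p M. \<exists>f\<in>u. strongly_measurable F f}"

text \<open>Norm, integrals and algebraic operations on classes are computed on a representative; none
  of them depends on the representative up to equality almost everywhere.\<close>

definition rep :: "('a \<Rightarrow> 'y) set \<Rightarrow> 'a \<Rightarrow> 'y" where
  "rep u = (SOME f. f \<in> u)"

definition class_norm ::
  "ennreal \<Rightarrow> 'a measure \<Rightarrow> ('a \<Rightarrow> 'y::real_normed_vector) set \<Rightarrow> ennreal" where
  "class_norm p M u = Lp_norm p M (rep u)"

definition class_add :: "'a measure \<Rightarrow> ('a \<Rightarrow> 'y::real_normed_vector) set \<Rightarrow>
    ('a \<Rightarrow> 'y) set \<Rightarrow> ('a \<Rightarrow> 'y) set" where
  "class_add M u v = ae_class M (\<lambda>x. rep u x + rep v x)"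

definition class_smul :: "'a measure \<Rightarrow> ('k \<Rightarrow> 'y::real_normed_vector \<Rightarrow> 'y) \<Rightarrow>
    'k \<Rightarrow> ('a \<Rightarrow> 'y) set \<Rightarrow> ('a \<Rightarrow> 'y) set" where
  "class_smul M smul c u = ae_class M (\<lambda>x. smul c (rep u x))"

definition class_integral ::
  "'a measure \<Rightarrow> 'a set \<Rightarrow> ('a \<Rightarrow> 'y::real_normed_vector) set \<Rightarrow> 'y" where
  "class_integral M B u = strong_integral M (\<lambda>x. indicator B x *\<^sub>R rep u x)"

definition bounded_operator :: "ennreal \<Rightarrow> 'a measure \<Rightarrow>
    ('k \<Rightarrow> 'y::real_normed_vector \<Rightarrow> 'y) \<Rightarrow> (('a \<Rightarrow> 'y) set \<Rightarrow> ('a \<Rightarrow> 'y) set) \<Rightarrow> bool" where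
  "bounded_operator p M smul T \<longleftrightarrow>
    (\<forall>u\<in>Lp p M. T u \<in> Lp p M) \<and>
    (\<forall>u\<in>Lp p M. \<forall>v\<in>Lp p M. T (class_add M u v) = class_add M (T u) (T v)) \<and>
    (\<forall>c. \<forall>u\<in>Lp p M. T (class_smul M smul c u) = class_smul M smul c (T u)) \<and>
    (\<exists>C::real. \<forall>u\<in>Lp p M. class_norm p M (T u) \<le> ennreal C * class_norm p M u)"

section \<open>Conditional expectation operators\<close>

text \<open>\<open>\<B>\<close> is the family of sets of \<open>F\<close> on which the integrals are required to agree.\<close>

definition cond_exp_operator :: "ennreal \<Rightarrow> 'a set set \<Rightarrow> 'a measure \<Rightarrow> 'a measure \<Rightarrow>
    ('k \<Rightarrow> 'y::real_normed_vector \<Rightarrow> 'y) \<Rightarrow> (('a \<Rightarrow> 'y) set \<Rightarrow> ('a \<Rightarrow> 'y) set) \<Rightarrow> bool" where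
  "cond_exp_operator p \<B> M F smul T \<longleftrightarrow>
    bounded_operator p M smul T \<and>
    (\<forall>u\<in>Lp p M.
      T u \<in> Lp_sub p M F \<and>
      (\<forall>B\<in>\<B>. class_integral M B u = class_integral M B (T u)) \<and>
      (\<forall>v\<in>Lp_sub p M F. (\<forall>B\<in>\<B>. class_integral M B u = class_integral M B v) \<longrightarrow> v = T u))"

definition cond_exp_L1 :: "'a measure \<Rightarrow> 'a measure \<Rightarrow>
    ('k \<Rightarrow> 'y::real_normed_vector \<Rightarrow> 'y) \<Rightarrow> (('a \<Rightarrow> 'y) set \<Rightarrow> ('a \<Rightarrow> 'y) set) \<Rightarrow> bool" where
  "cond_exp_L1 M F = cond_exp_operator 1 (sets F) M F"

definition cond_exp_Linf :: "'a measure \<Rightarrow> 'a measure \<Rightarrow>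
    ('k \<Rightarrow> 'y::real_normed_vector \<Rightarrow> 'y) \<Rightarrow> (('a \<Rightarrow> 'y) set \<Rightarrow> ('a \<Rightarrow> 'y) set) \<Rightarrow> bool" where
  "cond_exp_Linf M F = cond_exp_operator \<infinity> {B \<in> sets F. emeasure M B < \<infinity>} M F"

end

theory Submission
  imports Defs
begin

text \<open>Every strongly measurable f has a pointwise expansion f = sum_j 1_(A j) d_j whose partial sums
  of norms are at most 3 |f|. For f bounded by C, the expansion reduces the existence of a
  conditional expectation to scalar indicators: with h_j the conditional expectation of 1_(A j), the
  series sum_j h_j d_j converges absolutely almost everywhere, since the partial sums of
  h_j |d_j| have averages at most 3 C over every F-set of finite measure.

  The functions h_j are glued from Radon-Nikodym densities on the F-sets of finite measure; the
  Maharam property supplies their superlevel sets, one for each rational level.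

  Contractivity and uniqueness both follow from semi-finiteness of F: if the averages of v over
  F-sets of finite measure have norm at most c, then |v| <= c almost everywhere, because otherwise
  v would be close to a single y with |y| > c on such a set of positive measure.

  For the duality, both sides equal the integral of <E1 f, E g>. In each of the two comparisons one
  factor is F-measurable in both integrals, and expanding that factor in a series as above
  reduces the claim to integrals of the other factor over F-sets.\<close>

section \<open>Strong measurability and greedy series\<close>

text \<open>Two obstacles shape the route. For infinite-dimensional Y the simple functions are not
  norm dense in L\<infinity>, so the scalar operator cannot be extended from elementary tensors by
  density. And although Y-valued conditional expectations could be built on each F-set of finite
  measure, gluing them over uncountably many such sets might leave a function without separable
  range, whereas the Maharam property glues only sets. The expansion answers both: it involves a
  single sequence of vectors d_j, so only countably many scalar functions have to be glued, and the
  limit is strongly measurable because its partial sums are.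

  Pointwise convergence of the expansion alone would be too weak, since cancellation between the
  terms need not survive the passage from 1_(A j) to h_j. A bound on the nonnegative sums of 1_(A j)
  |d_j| does survive it, as it can be read off from averages. The factor 3 that this costs is
  removed at the end by comparing the averages of the limit with those of f.

  The L1 identity speaks of all F-sets, the L\<infinity> identity only of those of finite measure.
  The expansion of an integrable function uses, apart from zero terms, only sets on which its norm
  is bounded below, and these have finite measure.\<close>

text \<open>\<open>D'\<close> is the additive subgroup generated by \<open>D\<close>. Repeated
  subtraction of its elements never leads out of its closure, so one enumeration of candidates
  serves all later residuals.\<close>

lemma countable_subset_closed_diff:
  fixes D :: "'y::ab_group_add set"
  assumes "countable D"
  obtains D' where "countable D'" "D \<subseteq> D'" "\<And>a b. a \<in> D' \<Longrightarrow> b \<in> D' \<Longrightarrow> a - b \<in> D'"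
proof -
  define D' where "D' = (\<lambda>(xs, ys). sum_list xs - sum_list ys) ` (lists D \<times> lists D)"
  show ?thesis
  proof (rule that[of D'])
    show "countable D'"
      unfolding D'_def using assms by auto
    show "D \<subseteq> D'"
    proof
      fix d assume "d \<in> D"
      then show "d \<in> D'"
        unfolding D'_def by (intro image_eqI[where x="([d], [])"]) auto
    qed
    fix a b assume "a \<in> D'" "b \<in> D'"
    then obtain p q r s where "a = sum_list p - sum_list q" "b = sum_list r - sum_list s"
      "p \<in> lists D" "q \<in> lists D" "r \<in> lists D" "s \<in> lists D"
      unfolding D'_def by auto
    then show "a - b \<in> D'"
      unfolding D'_def by (intro image_eqI[where x="(p @ s, q @ r)"]) auto
  qed
qed

text \<open>An accepted \<open>d j\<close> has norm below 3/2 of that of the residual and lowers the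
  norm of the residual by more than 1/2 of it. Hence \<open>norm (d j)\<close> is at most 3 times
  the decrease, and the decreases telescope to at most \<open>norm (f x)\<close>. Borel
  measurability with separable range is assumed, so that the lemma also proves the converse half of
  \<open>strongly_measurable_iff_separable\<close>.\<close>

lemma borel_measurable_separable_series:
  fixes f :: "'a \<Rightarrow> 'y::real_normed_vector"
  assumes f: "f \<in> borel_measurable M" and D: "countable D" "f ` space M \<subseteq> closure D"
  obtains A :: "nat \<Rightarrow> 'a set" and d :: "nat \<Rightarrow> 'y" where
    "\<And>j. A j \<in> sets M"
    "\<And>n x. x \<in> space M \<Longrightarrow> (\<Sum>j<n. indicator (A j) x * norm (d j)) \<le> 3 * norm (f x)"
    "\<And>x. x \<in> space M \<Longrightarrow> (\<lambda>j. indicator (A j) x *\<^sub>R d j) sums f x"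
proof -
  from countable_subset_closed_diff[OF D(1)] obtain D0 where
    D0: "countable D0" "D \<subseteq> D0" "\<And>a b. a \<in> D0 \<Longrightarrow> b \<in> D0 \<Longrightarrow> a - b \<in> D0"
    by blast
  define d where "d j = from_nat_into D0 (fst (prod_decode j))" for j
  \<comment> \<open>Each element of \<open>D0\<close> occurs infinitely often among the \<open>d j\<close>. The residual \<open>r j\<close> drops \<open>d j\<close>
    whenever that at least halves its norm, so it cannot stay away from 0.\<close>
  define r where "r = rec_nat f (\<lambda>j g x. if norm (g x - d j) < norm (g x) / 2 then g x - d j else g x)"
  have r_0: "r 0 x = f x" and r_Suc: "r (Suc j) x =
      (if norm (r j x - d j) < norm (r j x) / 2 then r j x - d j else r j x)" for j x
    by (auto simp: r_def)
  define A where "A j = {x \<in> space M. norm (r j x - d j) < norm (r j x) / 2}" for j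
  have r_meas: "r j \<in> borel_measurable M" and A: "A j \<in> sets M" for j
  proof -
    have A': "A j \<in> sets M" if [measurable]: "r j \<in> borel_measurable M" for j
    proof -
      \<comment> \<open>Differences of two Borel functions may fail to be Borel in a nonseparable
        space. Here the subtracted vector is fixed, so composition with a continuous map of one
        variable suffices.\<close>
      have [measurable]: "(\<lambda>x. norm (r j x - d j)) \<in> borel_measurable M"
        by (rule measurable_compose[OF that, of "\<lambda>y. norm (y - d j)"])
          (intro borel_measurable_continuous_onI continuous_intros)
      show ?thesis
        unfolding A_def by measurable
    qed
    show *: "r j \<in> borel_measurable M" for j
    proof (induction j)
      case 0
      show ?case using f by (simp add: r_def)
    next
      case (Suc j)
      have "(\<lambda>x. r j x - d j) \<in> borel_measurable M"
        by (rule measurable_compose[OF Suc, of "\<lambda>y. y - d j"])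
          (intro borel_measurable_continuous_onI continuous_intros)
      moreover have "r (Suc j) = (\<lambda>x. if norm (r j x - d j) < norm (r j x) / 2 then r j x - d j else r j x)"
        by (simp add: r_Suc fun_eq_iff)
      ultimately show ?case
        using A'[OF Suc] Suc by (auto intro!: measurable_If simp: A_def)
    qed
    show "A j \<in> sets M" by (rule A'[OF *])
  qed
  have r_step: "r (Suc j) x = r j x - indicator (A j) x *\<^sub>R d j" if "x \<in> space M" for j x
    using that by (simp add: r_Suc A_def indicator_def)
  have d_le: "indicator (A j) x * norm (d j) \<le> 3 * (norm (r j x) - norm (r (Suc j) x))"
    if "x \<in> space M" for j x
  proof (cases "x \<in> A j")
    case True
    then have "norm (r j x - d j) < norm (r j x) / 2" "r (Suc j) x = r j x - d j"
      using that by (auto simp: A_def r_Suc)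
    moreover have "norm (d j) \<le> norm (r j x) + norm (r j x - d j)"
      by (metis norm_minus_commute norm_triangle_sub)
    ultimately show ?thesis
      using True by (simp add: indicator_def)
  next
    case False
    then show ?thesis using that by (simp add: r_Suc A_def)
  qed
  have r_anti: "norm (r (Suc j) x) \<le> norm (r j x)" if "x \<in> space M" for j x
  proof -
    have "0 \<le> indicator (A j) x * norm (d j)" by (simp add: indicator_def)
    also note d_le[OF that, of j]
    finally show ?thesis by simp
  qed
  \<comment> \<open>Once the norms of the residuals have almost converged, the residuals themselves
    hardly move. A vector close to \<open>r N x\<close> therefore stays close to every later
    residual.\<close>
  have tail: "norm (r N x - r (N + m) x) \<le> 3 * (norm (r N x) - norm (r (N + m) x))"
    if "x \<in> space M" for N m x
  proof (induction m)
    case (Suc m)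
    have "norm (r N x - r (N + Suc m) x)
        \<le> norm (r N x - r (N + m) x) + norm (r (N + m) x - r (N + Suc m) x)"
      by (metis diff_add_cancel add_diff_eq norm_triangle_ineq)
    also have "norm (r (N + m) x - r (N + Suc m) x) = indicator (A (N + m)) x * norm (d (N + m))"
      using r_step[OF that, of "N + m"] by (simp add: indicator_def)
    finally show ?case
      using Suc d_le[OF that, of "N + m"] by simp
  qed simp
  have f_sum: "f x = (\<Sum>j<n. indicator (A j) x *\<^sub>R d j) + r n x" if "x \<in> space M" for n x
    using that by (induction n) (auto simp: r_0 r_step)
  have sum_le: "(\<Sum>j<n. indicator (A j) x * norm (d j)) \<le> 3 * norm (f x)" if "x \<in> space M" for n x
  proof -
    have "(\<Sum>j<n. indicator (A j) x * norm (d j)) \<le> (\<Sum>j<n. 3 * (norm (r j x) - norm (r (Suc j) x)))"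
      by (intro sum_mono d_le that)
    also have "\<dots> = 3 * (norm (r 0 x) - norm (r n x))"
      by (simp only: sum_distrib_left[symmetric] sum_lessThan_telescope'[of "\<lambda>j. norm (r j x)"])
    also have "\<dots> \<le> 3 * norm (f x)" by (simp add: r_0)
    finally show ?thesis .
  qed
  have r_cl: "r j x \<in> closure D0" if "x \<in> space M" for j x
  proof (induction j)
    case 0
    show ?case using that D(2) closure_mono[OF D0(2)] by (auto simp: r_0)
  next
    case (Suc j)
    \<comment> \<open>For empty \<open>D0\<close> the values \<open>from_nat_into D0\<close> are
      arbitrary; a point in its closure excludes this case.\<close>
    then have "D0 \<noteq> {}" by auto
    then have dj: "d j \<in> D0" by (simp add: d_def from_nat_into)
    have "r j x - d j \<in> closure D0"
      unfolding closure_approachable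
    proof (intro allI impI)
      fix e :: real assume "0 < e"
      then obtain y where "y \<in> D0" "dist y (r j x) < e"
        using Suc unfolding closure_approachable by blast
      then show "\<exists>y\<in>D0. dist y (r j x - d j) < e"
        using D0(3)[OF _ dj] by (intro bexI[of _ "y - d j"]) (auto simp: dist_norm)
    qed
    with Suc show ?case by (simp add: r_Suc)
  qed
  have lim: "(\<lambda>n. r n x) \<longlonglongrightarrow> 0" if x: "x \<in> space M" for x
  proof -
    have dec: "decseq (\<lambda>n. norm (r n x))"
      using r_anti[OF x] by (intro decseq_SucI)
    then obtain L where L: "(\<lambda>n. norm (r n x)) \<longlonglongrightarrow> L" "\<And>n. L \<le> norm (r n x)"
      using decseq_convergent[of "\<lambda>n. norm (r n x)" 0] by auto
    have "L \<ge> 0" using L(1) by (rule LIMSEQ_le_const) auto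
    moreover have "\<not> L > 0"
    proof
      assume "L > 0"
      \<comment> \<open>By \<open>tail\<close>, a remaining decrease below L/24 means a movement
        below 3 * L/24 = L/8. With a candidate within L/8 of \<open>r N x\<close>, the distance to a
        later residual stays below L/4, which is at most half of its norm. The candidate is then
        accepted and leaves a residual of norm below L/4 < L.\<close>
      then have "\<forall>\<^sub>F n in sequentially. norm (r n x) < L + L / 24"
        using L(1) by (intro order_tendstoD) auto
      then obtain N where N: "norm (r N x) < L + L / 24"
        by (auto simp: eventually_sequentially)
      obtain y where y: "y \<in> D0" "dist y (r N x) < L / 8"
        using r_cl[OF x, of N] \<open>L > 0\<close> unfolding closure_approachable by (meson zero_less_divide_iff zero_less_numeral)
      obtain i where i: "y = from_nat_into D0 i"
        using from_nat_into_surj[OF D0(1) y(1)] by metis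
      \<comment> \<open>The second component only pushes the index of this occurrence of
        \<open>y\<close> beyond \<open>N\<close>.\<close>
      define j where "j = prod_encode (i, N)"
      have j: "d j = y" "N \<le> j"
        by (auto simp: j_def d_def i le_prod_encode_2)
      have "norm (r N x - r j x) \<le> 3 * (norm (r N x) - norm (r j x))"
        using tail[OF x, of N "j - N"] j by simp
      also have "\<dots> < L / 8" using N L(2)[of j] by simp
      finally have "norm (r N x - r j x) < L / 8" .
      moreover have "norm (r j x - y) \<le> norm (r N x - r j x) + dist y (r N x)"
        by (metis dist_norm dist_commute dist_triangle3 add.commute)
      ultimately have *: "norm (r j x - d j) < L / 4"
        using y j by simp
      moreover have "L / 4 \<le> norm (r j x) / 2" using L(2)[of j] \<open>L > 0\<close> by simp
      ultimately have "norm (r j x - d j) < norm (r j x) / 2" by linarith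
      then have "norm (r (Suc j) x) < L / 4" using * by (simp add: r_Suc)
      with L(2)[of "Suc j"] \<open>L > 0\<close> show False by simp
    qed
    ultimately have "L = 0" by simp
    with L(1) show ?thesis using tendsto_norm_zero_iff by blast
  qed
  show ?thesis
  proof (rule that[OF A sum_le])
    fix x assume x: "x \<in> space M"
    have "(\<lambda>n. f x - r n x) \<longlonglongrightarrow> f x - 0"
      by (intro tendsto_intros lim x)
    moreover have "(\<lambda>n. f x - r n x) = (\<lambda>n. \<Sum>j<n. indicator (A j) x *\<^sub>R d j)"
    proof
      fix n show "f x - r n x = (\<Sum>j<n. indicator (A j) x *\<^sub>R d j)"
        using f_sum[OF x, of n] by (simp add: algebra_simps)
    qed
    ultimately show "(\<lambda>j. indicator (A j) x *\<^sub>R d j) sums f x"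
      unfolding sums_def by simp
  qed auto
qed

section \<open>Strong measurability as Borel measurability with separable range\<close>

lemma strongly_measurable_borel:
  fixes f :: "'a \<Rightarrow> 'y::real_normed_vector"
  assumes "strongly_measurable M f"
  shows "f \<in> borel_measurable M"
proof -
  obtain s where s: "\<And>i::nat. simple_function M (s i)"
    "\<And>x. x \<in> space M \<Longrightarrow> (\<lambda>i. s i x) \<longlonglongrightarrow> f x"
    using assms unfolding strongly_measurable_def by blast
  show ?thesis
    by (rule borel_measurable_LIMSEQ_metric[of s]) (auto intro: s borel_measurable_simple_function)
qed

lemma strongly_measurable_separable:
  fixes f :: "'a \<Rightarrow> 'y::real_normed_vector"
  assumes "strongly_measurable M f"
  obtains D where "countable D" "f ` space M \<subseteq> closure D"
proof -
  obtain s where s: "\<And>i::nat. simple_function M (s i)"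
    "\<And>x. x \<in> space M \<Longrightarrow> (\<lambda>i. s i x) \<longlonglongrightarrow> f x"
    using assms unfolding strongly_measurable_def by blast
  show ?thesis
  proof (rule that[of "\<Union>i. s i ` space M"])
    show "countable (\<Union>i. s i ` space M)"
      using s(1) by (intro countable_UN) (auto intro: countable_finite simple_functionD)
    show "f ` space M \<subseteq> closure (\<Union>i. s i ` space M)"
      using s(2) by (fastforce simp: closure_sequential)
  qed
qed

lemma strongly_measurable_series:
  fixes f :: "'a \<Rightarrow> 'y::real_normed_vector"
  assumes "strongly_measurable M f"
  obtains A :: "nat \<Rightarrow> 'a set" and d :: "nat \<Rightarrow> 'y" where
    "\<And>j. A j \<in> sets M"
    "\<And>n x. x \<in> space M \<Longrightarrow> (\<Sum>j<n. indicator (A j) x * norm (d j)) \<le> 3 * norm (f x)"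
    "\<And>x. x \<in> space M \<Longrightarrow> (\<lambda>j. indicator (A j) x *\<^sub>R d j) sums f x"
proof -
  obtain D where "countable D" "f ` space M \<subseteq> closure D"
    by (rule strongly_measurable_separable[OF assms])
  then show thesis
    by (rule borel_measurable_separable_series[OF strongly_measurable_borel[OF assms]])
      (rule that; assumption)
qed

lemma simple_function_indicator_scaleR:
  "A \<in> sets M \<Longrightarrow> simple_function M (\<lambda>x. indicator A x *\<^sub>R (d::'y::real_normed_vector))"
  using simple_function_compose1[OF simple_function_indicator, of A M "\<lambda>r::real. r *\<^sub>R d"] by simp

lemma strongly_measurable_simple:
  "simple_function M f \<Longrightarrow> strongly_measurable M f"
  unfolding strongly_measurable_def by (intro exI[of _ "\<lambda>_. f"]) auto

text \<open>Both conditions on the right pass to pointwise limits of sequences, which is hard to see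
  from approximability by simple functions. For the converse, the partial sums of the greedy series
  are the approximating simple functions.\<close>

lemma strongly_measurable_iff_separable:
  fixes f :: "'a \<Rightarrow> 'y::real_normed_vector"
  shows "strongly_measurable M f \<longleftrightarrow>
    f \<in> borel_measurable M \<and> (\<exists>D. countable D \<and> f ` space M \<subseteq> closure D)"
proof
  assume "strongly_measurable M f"
  then show "f \<in> borel_measurable M \<and> (\<exists>D. countable D \<and> f ` space M \<subseteq> closure D)"
    by (metis strongly_measurable_borel strongly_measurable_separable)
next
  assume "f \<in> borel_measurable M \<and> (\<exists>D. countable D \<and> f ` space M \<subseteq> closure D)"
  then obtain D where "f \<in> borel_measurable M" "countable D" "f ` space M \<subseteq> closure D"
    by blast
  then obtain A :: "nat \<Rightarrow> 'a set" and d where A: "\<And>j. A j \<in> sets M"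
    "\<And>n x. x \<in> space M \<Longrightarrow> (\<Sum>j<n. indicator (A j) x * norm (d j)) \<le> 3 * norm (f x)"
    "\<And>x. x \<in> space M \<Longrightarrow> (\<lambda>j. indicator (A j) x *\<^sub>R d j) sums f x"
    by (rule borel_measurable_separable_series) (rule that; assumption)
  show "strongly_measurable M f"
    unfolding strongly_measurable_def
  proof (intro exI[of _ "\<lambda>n x. \<Sum>j<n. indicator (A j) x *\<^sub>R d j"] conjI allI ballI)
    show "simple_function M (\<lambda>x. \<Sum>j<n. indicator (A j) x *\<^sub>R d j)" for n
      by (intro simple_function_sum simple_function_indicator_scaleR A)
  qed (use A(3) in \<open>simp add: sums_def\<close>)
qed

lemma strongly_measurable_LIMSEQ:
  fixes f :: "'a \<Rightarrow> 'y::real_normed_vector"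
  assumes s: "\<And>i::nat. strongly_measurable M (s i)"
    and lim: "\<And>x. x \<in> space M \<Longrightarrow> (\<lambda>i. s i x) \<longlonglongrightarrow> f x"
  shows "strongly_measurable M f"
proof -
  have "\<forall>i. \<exists>D. countable D \<and> s i ` space M \<subseteq> closure D"
    using s by (simp add: strongly_measurable_iff_separable)
  then obtain D where D: "\<And>i. countable (D i)" "\<And>i. s i ` space M \<subseteq> closure (D i)"
    by metis
  have "f x \<in> closure (\<Union>i. D i)" if "x \<in> space M" for x
  proof (rule closed_sequentially[OF closed_closure _ lim[OF that]])
    show "s i x \<in> closure (\<Union>i. D i)" for i
      using D(2)[of i] closure_mono[of "D i" "\<Union>i. D i"] that by blast
  qed
  moreover have "f \<in> borel_measurable M"
    by (rule borel_measurable_LIMSEQ_metric[of s]) (auto intro: strongly_measurable_borel s lim)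
  ultimately show ?thesis
    unfolding strongly_measurable_iff_separable using D(1)
    by (auto intro!: exI[of _ "\<Union>i. D i"])
qed

text \<open>Over a nonseparable space the product of the Borel algebras can be smaller than the
  Borel algebra of the product, so measurability of the pair does not compose with a continuous
  \<open>h\<close>. Pairs of simple approximants do.\<close>

lemma strongly_measurable_compose2:
  assumes f: "strongly_measurable M f" and g: "strongly_measurable M g"
    and h: "continuous_on UNIV (\<lambda>p. h (fst p) (snd p))"
  shows "strongly_measurable M (\<lambda>x. h (f x) (g x))"
proof -
  obtain s where s: "\<And>i::nat. simple_function M (s i)"
    "\<And>x. x \<in> space M \<Longrightarrow> (\<lambda>i. s i x) \<longlonglongrightarrow> f x"
    using f unfolding strongly_measurable_def by blast
  obtain t where t: "\<And>i::nat. simple_function M (t i)"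
    "\<And>x. x \<in> space M \<Longrightarrow> (\<lambda>i. t i x) \<longlonglongrightarrow> g x"
    using g unfolding strongly_measurable_def by blast
  show ?thesis
    unfolding strongly_measurable_def
  proof (intro exI[of _ "\<lambda>i x. h (s i x) (t i x)"] conjI allI ballI)
    show "simple_function M (\<lambda>x. h (s i x) (t i x))" for i
      by (rule simple_function_compose2[OF s(1) t(1)])
    fix x assume x: "x \<in> space M"
    show "(\<lambda>i. h (s i x) (t i x)) \<longlonglongrightarrow> h (f x) (g x)"
      using continuous_on_tendsto_compose[OF h tendsto_Pair[OF s(2)[OF x] t(2)[OF x]]] by simp
  qed
qed

section \<open>Closure properties of strong measurability\<close>

lemma strongly_measurable_compose:
  "strongly_measurable M f \<Longrightarrow> continuous_on UNIV h \<Longrightarrow> strongly_measurable M (\<lambda>x. h (f x))"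
  by (rule strongly_measurable_compose2[where h="\<lambda>x y. h x"])
    (auto intro!: continuous_on_compose2[of UNIV h] continuous_intros)

lemma strongly_measurable_add:
  "strongly_measurable M f \<Longrightarrow> strongly_measurable M g \<Longrightarrow> strongly_measurable M (\<lambda>x. f x + g x)"
  by (rule strongly_measurable_compose2[where h="(+)"]) (auto intro!: continuous_intros)

lemma strongly_measurable_diff:
  "strongly_measurable M f \<Longrightarrow> strongly_measurable M g \<Longrightarrow> strongly_measurable M (\<lambda>x. f x - g x)"
  by (rule strongly_measurable_compose2[where h="(-)"]) (auto intro!: continuous_intros)

lemma strongly_measurable_scaleR:
  "strongly_measurable M f \<Longrightarrow> strongly_measurable M g \<Longrightarrow> strongly_measurable M (\<lambda>x. f x *\<^sub>R g x)"
  by (rule strongly_measurable_compose2[where h="(*\<^sub>R)"]) (auto intro!: continuous_intros)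

lemma strongly_measurable_bilinear:
  assumes "bounded_bilinear pair" "strongly_measurable M f" "strongly_measurable M g"
  shows "strongly_measurable M (\<lambda>x. pair (f x) (g x))"
  using assms(2,3) by (rule strongly_measurable_compose2)
    (intro bounded_bilinear.continuous_on[OF assms(1)] continuous_intros)

lemma strongly_measurable_const: "strongly_measurable M (\<lambda>_. c)"
  by (simp add: strongly_measurable_simple)

lemma strongly_measurable_indicator:
  "B \<in> sets M \<Longrightarrow> strongly_measurable M (indicator B :: 'a \<Rightarrow> real)"
  by (simp add: strongly_measurable_simple)

lemma strongly_measurable_indicator_scaleR:
  "B \<in> sets M \<Longrightarrow> strongly_measurable M f \<Longrightarrow> strongly_measurable M (\<lambda>x. indicator B x *\<^sub>R f x)"
  by (intro strongly_measurable_scaleR strongly_measurable_indicator)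

lemma strongly_measurable_sum:
  "(\<And>i. i \<in> I \<Longrightarrow> strongly_measurable M (f i)) \<Longrightarrow> strongly_measurable M (\<lambda>x. \<Sum>i\<in>I. f i x)"
  by (induction I rule: infinite_finite_induct)
    (auto intro: strongly_measurable_add strongly_measurable_const)

lemma strongly_measurable_norm:
  "strongly_measurable M f \<Longrightarrow> (\<lambda>x. norm (f x)) \<in> borel_measurable M"
  by (rule strongly_measurable_borel)
    (auto intro: strongly_measurable_compose continuous_intros)

lemma strongly_measurable_ennreal_norm:
  "strongly_measurable M f \<Longrightarrow> (\<lambda>x. ennreal (norm (f x))) \<in> borel_measurable M"
  using strongly_measurable_norm[of M f] by simp

lemma strongly_measurable_subalgebra:
  "subalgebra M F \<Longrightarrow> strongly_measurable F f \<Longrightarrow> strongly_measurable M f"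
  unfolding strongly_measurable_def subalgebra_def
  by (metis simple_function_subalgebra)

section \<open>The Bochner integral\<close>

lemma ennreal_tendsto_0_le:
  fixes f g :: "nat \<Rightarrow> ennreal"
  assumes "\<And>n. f n \<le> g n" "g \<longlonglongrightarrow> 0"
  shows "f \<longlonglongrightarrow> 0"
  by (rule tendsto_sandwich[of "\<lambda>_. 0" f sequentially g 0]) (use assms in auto)

text \<open>Bochner's criterion as a working notion: it can be checked by domination, and in Banach
  spaces it yields the approximating sequence that \<open>has_strong_integral\<close>
  demands.\<close>

definition strongly_integrable :: "'a measure \<Rightarrow> ('a \<Rightarrow> 'y::real_normed_vector) \<Rightarrow> bool" where
  "strongly_integrable M f \<longleftrightarrow>
    strongly_measurable M f \<and> (\<integral>\<^sup>+x. ennreal (norm (f x)) \<partial>M) < \<infinity>"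

lemma strongly_integrableD:
  assumes "strongly_integrable M f"
  shows "strongly_measurable M f" "(\<integral>\<^sup>+x. ennreal (norm (f x)) \<partial>M) < \<infinity>"
  using assms by (auto simp: strongly_integrable_def)

lemma simple_bochner_integrable_strongly_measurable:
  "Bochner_Integration.simple_bochner_integrable M s \<Longrightarrow> strongly_measurable M s"
  by (auto elim: simple_bochner_integrable.cases intro: strongly_measurable_simple)

lemma simple_bochner_integral_norm_le_nn_integral:
  fixes s :: "'a \<Rightarrow> 'y::real_normed_vector"
  assumes "Bochner_Integration.simple_bochner_integrable M s"
  shows "ennreal (norm (Bochner_Integration.simple_bochner_integral M s))
    \<le> (\<integral>\<^sup>+x. ennreal (norm (s x)) \<partial>M)"
proof -
  have "ennreal (norm (Bochner_Integration.simple_bochner_integral M s))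
      \<le> ennreal (Bochner_Integration.simple_bochner_integral M (\<lambda>x. norm (s x)))"
    by (intro ennreal_leI simple_bochner_integral_norm_bound assms)
  also have "\<dots> = (\<integral>\<^sup>+x. ennreal (norm (s x)) \<partial>M)"
    using simple_bochner_integrable_compose2[of "\<lambda>x y. norm x" M s s] assms
    by (intro simple_bochner_integral_eq_nn_integral) auto
  finally show ?thesis .
qed

lemma nn_integral_norm_diff_le:
  fixes f g h :: "'a \<Rightarrow> 'y::real_normed_vector"
  assumes "strongly_measurable M f" "strongly_measurable M g" "strongly_measurable M h"
  shows "(\<integral>\<^sup>+x. ennreal (norm (f x - g x)) \<partial>M)
    \<le> (\<integral>\<^sup>+x. ennreal (norm (h x - f x)) \<partial>M) + (\<integral>\<^sup>+x. ennreal (norm (h x - g x)) \<partial>M)"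
proof -
  have "(\<integral>\<^sup>+x. ennreal (norm (f x - g x)) \<partial>M)
      \<le> (\<integral>\<^sup>+x. ennreal (norm (h x - f x)) + ennreal (norm (h x - g x)) \<partial>M)"
  proof (rule nn_integral_mono)
    fix x
    have "norm (f x - g x) \<le> norm (h x - f x) + norm (h x - g x)"
      by (metis norm_minus_commute norm_diff_triangle_le order_refl)
    then show "ennreal (norm (f x - g x)) \<le> ennreal (norm (h x - f x)) + ennreal (norm (h x - g x))"
      by (metis ennreal_leI ennreal_plus norm_ge_zero)
  qed
  also have "\<dots> = (\<integral>\<^sup>+x. ennreal (norm (h x - f x)) \<partial>M) + (\<integral>\<^sup>+x. ennreal (norm (h x - g x)) \<partial>M)"
    by (intro nn_integral_add strongly_measurable_ennreal_norm strongly_measurable_diff assms)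
  finally show ?thesis .
qed

text \<open>One estimate for two purposes: the integral does not depend on the approximating
  sequence, and the integrals along an approximating sequence are Cauchy.\<close>

lemma simple_bochner_integral_dist_le:
  fixes f :: "'a \<Rightarrow> 'y::real_normed_vector"
  assumes f: "strongly_measurable M f"
    and s: "Bochner_Integration.simple_bochner_integrable M s"
    and t: "Bochner_Integration.simple_bochner_integrable M t"
  shows "ennreal (norm (Bochner_Integration.simple_bochner_integral M s -
      Bochner_Integration.simple_bochner_integral M t))
    \<le> (\<integral>\<^sup>+x. ennreal (norm (f x - s x)) \<partial>M) + (\<integral>\<^sup>+x. ennreal (norm (f x - t x)) \<partial>M)"
proof -
  have "ennreal (norm (Bochner_Integration.simple_bochner_integral M s -
      Bochner_Integration.simple_bochner_integral M t))
    \<le> (\<integral>\<^sup>+x. ennreal (norm (s x - t x)) \<partial>M)"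
    using simple_bochner_integral_norm_le_nn_integral[of M "\<lambda>x. s x - t x"]
      simple_bochner_integrable_compose2[of "(-)" M s t] s t
    by (simp add: simple_bochner_integral_diff)
  also have "\<dots> \<le> (\<integral>\<^sup>+x. ennreal (norm (f x - s x)) \<partial>M) + (\<integral>\<^sup>+x. ennreal (norm (f x - t x)) \<partial>M)"
    by (intro nn_integral_norm_diff_le f simple_bochner_integrable_strongly_measurable s t)
  finally show ?thesis .
qed

lemma has_strong_integral_unique:
  fixes f :: "'a \<Rightarrow> 'y::real_normed_vector"
  assumes "has_strong_integral M f I" "has_strong_integral M f J"
  shows "I = J"
proof -
  obtain s where f: "strongly_measurable M f"
    and s: "\<And>i::nat. Bochner_Integration.simple_bochner_integrable M (s i)"
      "(\<lambda>i. \<integral>\<^sup>+ x. ennreal (norm (f x - s i x)) \<partial>M) \<longlonglongrightarrow> 0"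
      "(\<lambda>i. Bochner_Integration.simple_bochner_integral M (s i)) \<longlonglongrightarrow> I"
    using assms(1) unfolding has_strong_integral_def by blast
  obtain t where t: "\<And>i::nat. Bochner_Integration.simple_bochner_integrable M (t i)"
      "(\<lambda>i. \<integral>\<^sup>+ x. ennreal (norm (f x - t i x)) \<partial>M) \<longlonglongrightarrow> 0"
      "(\<lambda>i. Bochner_Integration.simple_bochner_integral M (t i)) \<longlonglongrightarrow> J"
    using assms(2) unfolding has_strong_integral_def by blast
  have 1: "(\<lambda>i. ennreal (norm (Bochner_Integration.simple_bochner_integral M (s i) -
      Bochner_Integration.simple_bochner_integral M (t i)))) \<longlonglongrightarrow> ennreal (norm (I - J))"
    by (intro tendsto_ennrealI tendsto_intros s t)
  have 2: "(\<lambda>i. (\<integral>\<^sup>+x. ennreal (norm (f x - s i x)) \<partial>M) + (\<integral>\<^sup>+x. ennreal (norm (f x - t i x)) \<partial>M))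
      \<longlonglongrightarrow> 0 + 0"
    by (intro tendsto_add s t)
  have "ennreal (norm (I - J)) \<le> 0 + 0"
    by (rule LIMSEQ_le[OF 1 2])
      (use simple_bochner_integral_dist_le[OF f s(1) t(1)] in auto)
  then show ?thesis
    by (simp add: ennreal_eq_0_iff)
qed

lemma strong_integral_eq:
  fixes f :: "'a \<Rightarrow> 'y::real_normed_vector"
  assumes "has_strong_integral M f I"
  shows "strong_integral M f = I"
proof -
  have "(THE I. has_strong_integral M f I) = I"
    by (rule the_equality[where P="has_strong_integral M f", OF assms]) (rule has_strong_integral_unique[OF _ assms])
  then show ?thesis
    unfolding strong_integral_def using assms by (simp only: if_P exI)
qed

text \<open>The partial sums of the greedy series are simple and dominated by 3 times the norm of
  \<open>f\<close>, so scalar dominated convergence makes them converge to \<open>f\<close> in mean.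
  Completeness of \<open>'y\<close> then provides the limit of their integrals.\<close>

lemma strongly_integrable_has_strong_integral:
  fixes f :: "'a \<Rightarrow> 'y::banach"
  assumes "strongly_integrable M f"
  shows "has_strong_integral M f (strong_integral M f)"
proof -
  note f = strongly_integrableD[OF assms]
  obtain A :: "nat \<Rightarrow> 'a set" and d where A: "\<And>j. A j \<in> sets M"
    "\<And>n x. x \<in> space M \<Longrightarrow> (\<Sum>j<n. indicator (A j) x * norm (d j)) \<le> 3 * norm (f x)"
    "\<And>x. x \<in> space M \<Longrightarrow> (\<lambda>j. indicator (A j) x *\<^sub>R d j) sums f x"
    by (rule strongly_measurable_series[OF f(1)]) (rule that; assumption)
  define s where "s n x = (\<Sum>j<n. indicator (A j) x *\<^sub>R d j)" for n x
  have s_simple: "simple_function M (s n)" for n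
    unfolding s_def by (intro simple_function_sum simple_function_indicator_scaleR A)
  have s_le: "norm (s n x) \<le> 3 * norm (f x)" if "x \<in> space M" for n x
  proof -
    have "norm (s n x) \<le> (\<Sum>j<n. norm (indicator (A j) x *\<^sub>R d j))"
      unfolding s_def by (rule norm_sum)
    also have "\<dots> = (\<Sum>j<n. indicator (A j) x * norm (d j))"
      by (intro sum.cong) (auto simp: indicator_def)
    finally show ?thesis using A(2)[OF that, of n] by linarith
  qed
  have f3: "(\<integral>\<^sup>+x. ennreal (c * norm (f x)) \<partial>M) < \<infinity>" if "c \<ge> 0" for c
    using f strongly_measurable_ennreal_norm[OF f(1)] that
    by (simp add: ennreal_mult nn_integral_cmult ennreal_mult_less_top)
  have s: "Bochner_Integration.simple_bochner_integrable M (s n)" for n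
  proof (rule simple_bochner_integrableI_bounded[OF s_simple])
    have "(\<integral>\<^sup>+x. ennreal (norm (s n x)) \<partial>M) \<le> (\<integral>\<^sup>+x. ennreal (3 * norm (f x)) \<partial>M)"
      by (intro nn_integral_mono ennreal_leI s_le)
    with f3[of 3] show "(\<integral>\<^sup>+x. ennreal (norm (s n x)) \<partial>M) < \<infinity>"
      using order.strict_trans1 by fastforce
  qed
  have lim: "(\<lambda>n. \<integral>\<^sup>+x. ennreal (norm (f x - s n x)) \<partial>M) \<longlonglongrightarrow> (\<integral>\<^sup>+x. 0 \<partial>M)"
  \<comment> \<open>The 4 is 1 for \<open>f\<close> plus 3 for the partial sum.\<close>
  proof (rule nn_integral_dominated_convergence[where w="\<lambda>x. ennreal (4 * norm (f x))"])
    show "(\<lambda>x. ennreal (norm (f x - s n x))) \<in> borel_measurable M" for n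
      by (intro strongly_measurable_ennreal_norm strongly_measurable_diff f
          strongly_measurable_simple s_simple)
    show "(\<lambda>x. ennreal (4 * norm (f x))) \<in> borel_measurable M"
      using strongly_measurable_norm[OF f(1)] by simp
    show "AE x in M. ennreal (norm (f x - s n x)) \<le> ennreal (4 * norm (f x))" for n
    proof (rule AE_I2)
      fix x assume "x \<in> space M"
      from s_le[OF this, of n] have "norm (f x - s n x) \<le> 4 * norm (f x)"
        using norm_triangle_ineq4[of "f x" "s n x"] by linarith
      then show "ennreal (norm (f x - s n x)) \<le> ennreal (4 * norm (f x))"
        by (rule ennreal_leI)
    qed
    show "AE x in M. (\<lambda>n. ennreal (norm (f x - s n x))) \<longlonglongrightarrow> 0"
    proof (rule AE_I2)
      fix x assume "x \<in> space M"
      then have "(\<lambda>n. s n x) \<longlonglongrightarrow> f x"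
        using A(3) by (simp add: sums_def s_def)
      then have "(\<lambda>n. ennreal (norm (f x - s n x))) \<longlonglongrightarrow> ennreal (norm (f x - f x))"
        by (intro tendsto_ennrealI tendsto_intros)
      then show "(\<lambda>n. ennreal (norm (f x - s n x))) \<longlonglongrightarrow> 0" by simp
    qed
  qed (use f3[of 4] in auto)
  then have lim0: "(\<lambda>n. \<integral>\<^sup>+x. ennreal (norm (f x - s n x)) \<partial>M) \<longlonglongrightarrow> 0" by simp
  have "Cauchy (\<lambda>n. Bochner_Integration.simple_bochner_integral M (s n))"
  proof (rule metric_CauchyI)
    fix e :: real assume "e > 0"
    then have "\<forall>\<^sub>F n in sequentially. (\<integral>\<^sup>+x. ennreal (norm (f x - s n x)) \<partial>M) < ennreal (e / 2)"
      using lim0 by (intro order_tendstoD(2)[OF lim0]) auto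
    then obtain N where N: "\<And>n. n \<ge> N \<Longrightarrow> (\<integral>\<^sup>+x. ennreal (norm (f x - s n x)) \<partial>M) < ennreal (e / 2)"
      by (auto simp: eventually_sequentially)
    show "\<exists>N. \<forall>m\<ge>N. \<forall>n\<ge>N. dist (Bochner_Integration.simple_bochner_integral M (s m))
      (Bochner_Integration.simple_bochner_integral M (s n)) < e"
    proof (intro exI[of _ N] allI impI)
      fix m n assume "m \<ge> N" "n \<ge> N"
      have "ennreal (dist (Bochner_Integration.simple_bochner_integral M (s m))
          (Bochner_Integration.simple_bochner_integral M (s n))) < ennreal (e / 2) + ennreal (e / 2)"
        using simple_bochner_integral_dist_le[OF f(1) s[of m] s[of n]]
          add_strict_mono[OF N[OF \<open>m \<ge> N\<close>] N[OF \<open>n \<ge> N\<close>]]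
        unfolding dist_norm by (rule order.strict_trans1)
      also have "\<dots> = ennreal e"
        using \<open>e > 0\<close> by (simp add: ennreal_plus[symmetric] del: ennreal_plus)
      finally show "dist (Bochner_Integration.simple_bochner_integral M (s m))
          (Bochner_Integration.simple_bochner_integral M (s n)) < e"
        using \<open>e > 0\<close> by (simp add: ennreal_less_iff)
    qed
  qed
  then obtain I where "(\<lambda>n. Bochner_Integration.simple_bochner_integral M (s n)) \<longlonglongrightarrow> I"
    using Cauchy_convergent convergent_def by blast
  then have "has_strong_integral M f I"
    unfolding has_strong_integral_def using f(1) s lim0 by blast
  then show ?thesis by (simp add: strong_integral_eq)
qed

lemma has_strong_integral_add:
  fixes f g :: "'a \<Rightarrow> 'y::real_normed_vector"
  assumes "has_strong_integral M f I" "has_strong_integral M g J"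
  shows "has_strong_integral M (\<lambda>x. f x + g x) (I + J)"
proof -
  obtain s where f: "strongly_measurable M f"
    and s: "\<And>i::nat. Bochner_Integration.simple_bochner_integrable M (s i)"
      "(\<lambda>i. \<integral>\<^sup>+ x. ennreal (norm (f x - s i x)) \<partial>M) \<longlonglongrightarrow> 0"
      "(\<lambda>i. Bochner_Integration.simple_bochner_integral M (s i)) \<longlonglongrightarrow> I"
    using assms(1) unfolding has_strong_integral_def by blast
  obtain t where g: "strongly_measurable M g"
    and t: "\<And>i::nat. Bochner_Integration.simple_bochner_integrable M (t i)"
      "(\<lambda>i. \<integral>\<^sup>+ x. ennreal (norm (g x - t i x)) \<partial>M) \<longlonglongrightarrow> 0"
      "(\<lambda>i. Bochner_Integration.simple_bochner_integral M (t i)) \<longlonglongrightarrow> J"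
    using assms(2) unfolding has_strong_integral_def by blast
  have le: "(\<integral>\<^sup>+ x. ennreal (norm (f x + g x - (s i x + t i x))) \<partial>M)
      \<le> (\<integral>\<^sup>+ x. ennreal (norm (f x - s i x)) \<partial>M) + (\<integral>\<^sup>+ x. ennreal (norm (g x - t i x)) \<partial>M)" for i
  proof -
    have "(\<integral>\<^sup>+ x. ennreal (norm (f x + g x - (s i x + t i x))) \<partial>M)
        \<le> (\<integral>\<^sup>+ x. ennreal (norm (f x - s i x)) + ennreal (norm (g x - t i x)) \<partial>M)"
      by (intro nn_integral_mono) (metis ennreal_leI ennreal_plus norm_diff_triangle_ineq norm_ge_zero)
    also have "\<dots> = (\<integral>\<^sup>+ x. ennreal (norm (f x - s i x)) \<partial>M) + (\<integral>\<^sup>+ x. ennreal (norm (g x - t i x)) \<partial>M)"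
      by (intro nn_integral_add strongly_measurable_ennreal_norm strongly_measurable_diff f g
          simple_bochner_integrable_strongly_measurable s t)
    finally show ?thesis .
  qed
  have "(\<lambda>i. (\<integral>\<^sup>+ x. ennreal (norm (f x - s i x)) \<partial>M) + (\<integral>\<^sup>+ x. ennreal (norm (g x - t i x)) \<partial>M)) \<longlonglongrightarrow> 0"
    using tendsto_add[OF s(2) t(2)] by simp
  with le have "(\<lambda>i. \<integral>\<^sup>+ x. ennreal (norm (f x + g x - (s i x + t i x))) \<partial>M) \<longlonglongrightarrow> 0"
    by (rule ennreal_tendsto_0_le)
  moreover have "(\<lambda>i. Bochner_Integration.simple_bochner_integral M (\<lambda>x. s i x + t i x)) \<longlonglongrightarrow> I + J"
    using s t by (auto simp: simple_bochner_integral_add intro!: tendsto_intros)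
  moreover have "Bochner_Integration.simple_bochner_integrable M (\<lambda>x. s i x + t i x)" for i
    by (rule simple_bochner_integrable_compose2[of "(+)", OF _ s(1) t(1)]) simp
  ultimately show ?thesis
    unfolding has_strong_integral_def using strongly_measurable_add[OF f g]
    by (intro conjI exI[of _ "\<lambda>i x. s i x + t i x"]) auto
qed

text \<open>Later applied to negation, to r \<mapsto> r d for a fixed vector d, to
  \<open>smul c\<close> and to \<open>pair (d j)\<close>; this is how constants leave integrals
  throughout.\<close>

lemma has_strong_integral_bounded_linear:
  fixes f :: "'a \<Rightarrow> 'y::real_normed_vector" and T :: "'y \<Rightarrow> 'z::real_normed_vector"
  assumes T: "bounded_linear T" and "has_strong_integral M f I"
  shows "has_strong_integral M (\<lambda>x. T (f x)) (T I)"
proof -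
  interpret T: bounded_linear T by fact
  obtain s where f: "strongly_measurable M f"
    and s: "\<And>i::nat. Bochner_Integration.simple_bochner_integrable M (s i)"
      "(\<lambda>i. \<integral>\<^sup>+ x. ennreal (norm (f x - s i x)) \<partial>M) \<longlonglongrightarrow> 0"
      "(\<lambda>i. Bochner_Integration.simple_bochner_integral M (s i)) \<longlonglongrightarrow> I"
    using assms(2) unfolding has_strong_integral_def by blast
  obtain K where K: "K > 0" "\<And>y. norm (T y) \<le> norm y * K"
    using T.pos_bounded by blast
  have le: "(\<integral>\<^sup>+ x. ennreal (norm (T (f x) - T (s i x))) \<partial>M)
      \<le> ennreal K * (\<integral>\<^sup>+ x. ennreal (norm (f x - s i x)) \<partial>M)" for i
  proof -
    have "(\<integral>\<^sup>+ x. ennreal (norm (T (f x) - T (s i x))) \<partial>M)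
        \<le> (\<integral>\<^sup>+ x. ennreal K * ennreal (norm (f x - s i x)) \<partial>M)"
    proof (rule nn_integral_mono)
      fix x
      have "norm (T (f x) - T (s i x)) \<le> K * norm (f x - s i x)"
        using K(2)[of "f x - s i x"] by (simp add: T.diff mult.commute)
      then show "ennreal (norm (T (f x) - T (s i x))) \<le> ennreal K * ennreal (norm (f x - s i x))"
        using K(1) by (simp add: ennreal_leI flip: ennreal_mult)
    qed
    also have "\<dots> = ennreal K * (\<integral>\<^sup>+ x. ennreal (norm (f x - s i x)) \<partial>M)"
      by (intro nn_integral_cmult strongly_measurable_ennreal_norm strongly_measurable_diff f
          simple_bochner_integrable_strongly_measurable s)
    finally show ?thesis .
  qed
  have "(\<lambda>i. ennreal K * (\<integral>\<^sup>+ x. ennreal (norm (f x - s i x)) \<partial>M)) \<longlonglongrightarrow> 0"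
    using ennreal_tendsto_cmult[OF _ s(2), of "ennreal K"] by simp
  with le have "(\<lambda>i. \<integral>\<^sup>+ x. ennreal (norm (T (f x) - T (s i x))) \<partial>M) \<longlonglongrightarrow> 0"
    by (rule ennreal_tendsto_0_le)
  moreover have "(\<lambda>i. Bochner_Integration.simple_bochner_integral M (\<lambda>x. T (s i x))) \<longlonglongrightarrow> T I"
    using s T.linear_axioms by (auto simp: simple_bochner_integral_linear intro!: T.tendsto)
  moreover have "Bochner_Integration.simple_bochner_integrable M (\<lambda>x. T (s i x))" for i
    using simple_bochner_integrable_compose2[OF _ s(1) s(1), of "\<lambda>x y. T x"] by (simp add: T.zero)
  ultimately show ?thesis
    unfolding has_strong_integral_def
    by (intro conjI exI[of _ "\<lambda>i x. T (s i x)"] strongly_measurable_compose[OF f] T.continuous_on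
        continuous_intros) auto
qed

lemma has_strong_integral_norm_le:
  fixes f :: "'a \<Rightarrow> 'y::real_normed_vector"
  assumes "has_strong_integral M f I"
  shows "ennreal (norm I) \<le> (\<integral>\<^sup>+x. ennreal (norm (f x)) \<partial>M)"
proof -
  obtain s where f: "strongly_measurable M f"
    and s: "\<And>i::nat. Bochner_Integration.simple_bochner_integrable M (s i)"
      "(\<lambda>i. \<integral>\<^sup>+ x. ennreal (norm (f x - s i x)) \<partial>M) \<longlonglongrightarrow> 0"
      "(\<lambda>i. Bochner_Integration.simple_bochner_integral M (s i)) \<longlonglongrightarrow> I"
    using assms unfolding has_strong_integral_def by blast
  have 1: "(\<lambda>i. ennreal (norm (Bochner_Integration.simple_bochner_integral M (s i)))) \<longlonglongrightarrow> ennreal (norm I)"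
    by (intro tendsto_ennrealI tendsto_intros s)
  have 2: "(\<lambda>i. (\<integral>\<^sup>+ x. ennreal (norm (f x - s i x)) \<partial>M) + (\<integral>\<^sup>+x. ennreal (norm (f x)) \<partial>M))
      \<longlonglongrightarrow> 0 + (\<integral>\<^sup>+x. ennreal (norm (f x)) \<partial>M)"
    by (intro tendsto_add s tendsto_const)
  \<comment> \<open>The triangle inequality for \<open>s i\<close> and 0, compared through
    \<open>f\<close>.\<close>
  have "ennreal (norm (Bochner_Integration.simple_bochner_integral M (s i)))
      \<le> (\<integral>\<^sup>+ x. ennreal (norm (f x - s i x)) \<partial>M) + (\<integral>\<^sup>+x. ennreal (norm (f x)) \<partial>M)" for i
    using simple_bochner_integral_norm_le_nn_integral[OF s(1)[of i]]
      nn_integral_norm_diff_le[OF simple_bochner_integrable_strongly_measurable[OF s(1)[of i]]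
        strongly_measurable_const[of M 0] f]
    by simp
  then show ?thesis
    using LIMSEQ_le[OF 1 2] by simp
qed

section \<open>Linearity, norm bound and convergence theorems for the integral\<close>

lemma strong_integral_add:
  fixes f g :: "'a \<Rightarrow> 'y::banach"
  assumes "strongly_integrable M f" "strongly_integrable M g"
  shows "strong_integral M (\<lambda>x. f x + g x) = strong_integral M f + strong_integral M g"
  by (rule strong_integral_eq[OF has_strong_integral_add[OF
        assms[THEN strongly_integrable_has_strong_integral]]])

lemma strong_integral_bounded_linear:
  fixes f :: "'a \<Rightarrow> 'y::banach" and T :: "'y \<Rightarrow> 'z::real_normed_vector"
  assumes "bounded_linear T" "strongly_integrable M f"
  shows "strong_integral M (\<lambda>x. T (f x)) = T (strong_integral M f)"
  by (rule strong_integral_eq[OF has_strong_integral_bounded_linear[OF assms(1)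
        strongly_integrable_has_strong_integral[OF assms(2)]]])

lemma strong_integral_norm_le:
  fixes f :: "'a \<Rightarrow> 'y::banach"
  assumes "strongly_integrable M f"
  shows "ennreal (norm (strong_integral M f)) \<le> (\<integral>\<^sup>+x. ennreal (norm (f x)) \<partial>M)"
  by (rule has_strong_integral_norm_le[OF strongly_integrable_has_strong_integral[OF assms]])

lemma strongly_integrable_bounded_linear:
  assumes T: "bounded_linear T" and f: "strongly_integrable M f"
  shows "strongly_integrable M (\<lambda>x. T (f x))"
proof -
  interpret T: bounded_linear T by fact
  note f = strongly_integrableD[OF f]
  obtain K where K: "K > 0" "\<And>y. norm (T y) \<le> norm y * K"
    using T.pos_bounded by blast
  have "(\<integral>\<^sup>+x. ennreal (norm (T (f x))) \<partial>M) \<le> (\<integral>\<^sup>+x. ennreal K * ennreal (norm (f x)) \<partial>M)"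
  proof (rule nn_integral_mono)
    fix x
    have "ennreal (norm (T (f x))) \<le> ennreal (K * norm (f x))"
      using K(2)[of "f x"] by (intro ennreal_leI) (simp add: mult.commute)
    then show "ennreal (norm (T (f x))) \<le> ennreal K * ennreal (norm (f x))"
      using K(1) by (simp add: ennreal_mult)
  qed
  also have "\<dots> < \<infinity>"
    using f(2) by (simp add: nn_integral_cmult strongly_measurable_ennreal_norm[OF f(1)] ennreal_mult_less_top)
  finally show ?thesis
    unfolding strongly_integrable_def
    by (intro conjI strongly_measurable_compose[OF f(1)] T.continuous_on continuous_intros)
qed

lemma strongly_integrable_add:
  assumes "strongly_integrable M f" "strongly_integrable M g"
  shows "strongly_integrable M (\<lambda>x. f x + g x)"
proof -
  note f = strongly_integrableD[OF assms(1)] and g = strongly_integrableD[OF assms(2)]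
  have "(\<integral>\<^sup>+x. ennreal (norm (f x + g x)) \<partial>M)
      \<le> (\<integral>\<^sup>+x. ennreal (norm (f x)) + ennreal (norm (g x)) \<partial>M)"
    by (intro nn_integral_mono) (metis ennreal_leI ennreal_plus norm_triangle_ineq norm_ge_zero)
  also have "\<dots> < \<infinity>"
    using f g by (subst nn_integral_add) (auto intro: strongly_measurable_norm)
  finally show ?thesis
    unfolding strongly_integrable_def using f(1) g(1) by (auto intro: strongly_measurable_add)
qed

lemma strongly_integrable_minus:
  "strongly_integrable M f \<Longrightarrow> strongly_integrable M (\<lambda>x. - f x)"
  using strongly_integrable_bounded_linear[OF bounded_linear_minus[OF bounded_linear_ident]] by blast

lemma strongly_integrable_diff:
  "strongly_integrable M f \<Longrightarrow> strongly_integrable M g \<Longrightarrow> strongly_integrable M (\<lambda>x. f x - g x)"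
  using strongly_integrable_add[OF _ strongly_integrable_minus, of M f g] by simp

lemma strong_integral_diff:
  fixes f g :: "'a \<Rightarrow> 'y::banach"
  assumes "strongly_integrable M f" "strongly_integrable M g"
  shows "strong_integral M (\<lambda>x. f x - g x) = strong_integral M f - strong_integral M g"
  using strong_integral_add[OF assms(1) strongly_integrable_minus[OF assms(2)]]
    strong_integral_bounded_linear[OF bounded_linear_minus[OF bounded_linear_ident] assms(2)]
  by simp

lemma strongly_integrable_zero: "strongly_integrable M (\<lambda>_. 0)"
  by (simp add: strongly_integrable_def strongly_measurable_const)

lemma strong_integral_zero: "strong_integral M (\<lambda>_. 0::'y::banach) = 0"
  using strong_integral_norm_le[of M "\<lambda>_. 0::'y", OF strongly_integrable_zero] by (simp add: ennreal_eq_0_iff)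

lemma strongly_integrable_sum:
  assumes "\<And>i. i \<in> I \<Longrightarrow> strongly_integrable M (f i)"
  shows "strongly_integrable M (\<lambda>x. \<Sum>i\<in>I. f i x)"
  using assms by (induction I rule: infinite_finite_induct)
    (auto intro: strongly_integrable_add strongly_integrable_zero)

lemma strong_integral_sum:
  fixes f :: "'i \<Rightarrow> 'a \<Rightarrow> 'y::banach"
  assumes "\<And>i. i \<in> I \<Longrightarrow> strongly_integrable M (f i)"
  shows "strong_integral M (\<lambda>x. \<Sum>i\<in>I. f i x) = (\<Sum>i\<in>I. strong_integral M (f i))"
  using assms by (induction I rule: infinite_finite_induct)
    (auto simp: strong_integral_zero strong_integral_add strongly_integrable_sum)

lemma strongly_integrable_bound:
  assumes "strongly_measurable M f" "strongly_integrable M g"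
    and "AE x in M. norm (f x) \<le> norm (g x)"
  shows "strongly_integrable M f"
proof -
  have "(\<integral>\<^sup>+x. ennreal (norm (f x)) \<partial>M) \<le> (\<integral>\<^sup>+x. ennreal (norm (g x)) \<partial>M)"
    using assms(3) by (intro nn_integral_mono_AE) (auto elim!: eventually_mono intro: ennreal_leI)
  with assms show ?thesis
    unfolding strongly_integrable_def using order.strict_trans1 by blast
qed

text \<open>Strong measurability of \<open>g\<close> is a separate hypothesis, because
  \<open>M\<close> may be incomplete and equality almost everywhere then does not transfer
  it.\<close>

lemma strong_integral_cong_AE:
  fixes f g :: "'a \<Rightarrow> 'y::banach"
  assumes f: "strongly_integrable M f" and g: "strongly_measurable M g" and eq: "AE x in M. f x = g x"
  shows "strongly_integrable M g" "strong_integral M f = strong_integral M g"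
proof -
  show g': "strongly_integrable M g"
    by (rule strongly_integrable_bound[OF g f]) (use eq in \<open>auto elim!: eventually_mono\<close>)
  have "(\<integral>\<^sup>+x. ennreal (norm (f x - g x)) \<partial>M) = (\<integral>\<^sup>+x. 0 \<partial>M)"
    using eq by (intro nn_integral_cong_AE) (auto elim!: eventually_mono)
  then show "strong_integral M f = strong_integral M g"
    using strong_integral_norm_le[OF strongly_integrable_diff[OF f g']] strong_integral_diff[OF f g']
    by (simp add: ennreal_eq_0_iff)
qed

lemma strong_integral_dominated_convergence:
  fixes f :: "'a \<Rightarrow> 'y::banach"
  assumes f: "strongly_measurable M f" and s: "\<And>n::nat. strongly_measurable M (s n)"
    and w: "strongly_integrable M (w :: 'a \<Rightarrow> real)"
    and lim: "AE x in M. (\<lambda>n. s n x) \<longlonglongrightarrow> f x"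
    and bound: "\<And>n. AE x in M. norm (s n x) \<le> w x"
  shows "(\<lambda>n. strong_integral M (s n)) \<longlonglongrightarrow> strong_integral M f"
proof -
  have s': "strongly_integrable M (s n)" for n
    by (rule strongly_integrable_bound[OF s w]) (use bound[of n] in \<open>auto elim!: eventually_mono\<close>)
  have "AE x in M. \<forall>n. norm (s n x) \<le> w x"
    using bound by (simp add: AE_all_countable)
  with lim have fw: "AE x in M. norm (f x) \<le> w x"
  proof eventually_elim
    fix x assume "(\<lambda>n. s n x) \<longlonglongrightarrow> f x" "\<forall>n. norm (s n x) \<le> w x"
    then show "norm (f x) \<le> w x"
      using LIMSEQ_le_const2[OF tendsto_norm] by blast
  qed
  have f': "strongly_integrable M f"
    by (rule strongly_integrable_bound[OF f w]) (use fw in \<open>auto elim!: eventually_mono\<close>)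
  note w' = strongly_integrableD[OF w]
  have "(\<lambda>n. \<integral>\<^sup>+x. ennreal (norm (s n x - f x)) \<partial>M) \<longlonglongrightarrow> (\<integral>\<^sup>+x. 0 \<partial>M)"
  proof (rule nn_integral_dominated_convergence[where w="\<lambda>x. 2 * ennreal (norm (w x))"])
    show "(\<lambda>x. ennreal (norm (s n x - f x))) \<in> borel_measurable M" for n
      by (intro strongly_measurable_ennreal_norm strongly_measurable_diff f s)
    show "(\<lambda>x. 2 * ennreal (norm (w x))) \<in> borel_measurable M"
      using strongly_measurable_borel[OF w'(1)] by simp
    show "AE x in M. ennreal (norm (s n x - f x)) \<le> 2 * ennreal (norm (w x))" for n
      using fw bound[of n]
    proof eventually_elim
      fix x assume "norm (f x) \<le> w x" "norm (s n x) \<le> w x"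
      then have "norm (s n x - f x) \<le> 2 * norm (w x)"
        using norm_triangle_ineq4[of "s n x" "f x"] by simp
      then have "ennreal (norm (s n x - f x)) \<le> ennreal (2 * norm (w x))" by (rule ennreal_leI)
      then show "ennreal (norm (s n x - f x)) \<le> 2 * ennreal (norm (w x))"
        by (simp add: ennreal_mult)
    qed
    show "(\<integral>\<^sup>+x. 2 * ennreal (norm (w x)) \<partial>M) < \<infinity>"
      using w'(2) strongly_measurable_ennreal_norm[OF w'(1)]
      by (subst nn_integral_cmult) (auto simp: ennreal_mult_less_top)
    show "AE x in M. (\<lambda>n. ennreal (norm (s n x - f x))) \<longlonglongrightarrow> 0"
      using lim
    proof eventually_elim
      fix x assume "(\<lambda>n. s n x) \<longlonglongrightarrow> f x"
      then have "(\<lambda>n. ennreal (norm (s n x - f x))) \<longlonglongrightarrow> ennreal (norm (f x - f x))"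
        by (intro tendsto_ennrealI tendsto_intros)
      then show "(\<lambda>n. ennreal (norm (s n x - f x))) \<longlonglongrightarrow> 0" by simp
    qed
  qed auto
  then have lim0: "(\<lambda>n. \<integral>\<^sup>+x. ennreal (norm (s n x - f x)) \<partial>M) \<longlonglongrightarrow> 0" by simp
  have "ennreal (norm (strong_integral M (s n) - strong_integral M f))
      \<le> (\<integral>\<^sup>+x. ennreal (norm (s n x - f x)) \<partial>M)" for n
    using strong_integral_norm_le[OF strongly_integrable_diff[OF s' f']] strong_integral_diff[OF s' f']
    by simp
  then have "(\<lambda>n. ennreal (norm (strong_integral M (s n) - strong_integral M f))) \<longlonglongrightarrow> 0"
    using lim0 by (rule ennreal_tendsto_0_le)
  then have "(\<lambda>n. norm (strong_integral M (s n) - strong_integral M f)) \<longlonglongrightarrow> 0"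
    by (subst (asm) ennreal_0[symmetric], subst (asm) tendsto_ennreal_iff) auto
  then show ?thesis
    using LIM_zero_cancel tendsto_norm_zero_iff by blast
qed

lemma strongly_integrable_iff_integrable:
  fixes f :: "'a \<Rightarrow> 'y::{banach,second_countable_topology}"
  shows "strongly_integrable M f \<longleftrightarrow> integrable M f"
  unfolding strongly_integrable_def integrable_iff_bounded
  by (simp add: strongly_measurable_iff_borel_measurable)

lemma strong_integral_eq_lebesgue_integral:
  fixes f :: "'a \<Rightarrow> 'y::{banach,second_countable_topology}"
  assumes "integrable M f"
  shows "strong_integral M f = integral\<^sup>L M f"
  using assms has_bochner_integral_integrable
  by (intro strong_integral_eq) (auto simp: has_strong_integral_iff_has_bochner_integral)

lemma strongly_integrable_indicator:
  assumes B: "B \<in> sets M" "emeasure M B < \<infinity>"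
    and f: "strongly_measurable M f" "AE x in M. norm (f x) \<le> C"
  shows "strongly_integrable M (\<lambda>x. indicator B x *\<^sub>R f x)"
proof (rule strongly_integrable_bound)
  show "strongly_measurable M (\<lambda>x. indicator B x *\<^sub>R f x)"
    by (intro strongly_measurable_indicator_scaleR B f)
  show "strongly_integrable M (\<lambda>x. indicator B x *\<^sub>R C)"
    using B by (simp add: strongly_integrable_iff_integrable)
  show "AE x in M. norm (indicator B x *\<^sub>R f x) \<le> norm (indicator B x *\<^sub>R C)"
    using f(2) by eventually_elim (auto simp: indicator_def)
qed

lemma strong_integral_indicator:
  assumes B: "B \<in> sets M" "emeasure M B < \<infinity>"
  shows "strong_integral M (\<lambda>x. indicator B x *\<^sub>R (y::'y::banach)) = measure M B *\<^sub>R y"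
proof -
  have "has_strong_integral M (indicator B :: 'a \<Rightarrow> real) (measure M B)"
    unfolding has_strong_integral_iff_has_bochner_integral
    by (rule has_bochner_integral_real_indicator[OF B])
  from has_strong_integral_bounded_linear[OF bounded_linear_scaleR_left this, of y]
  show ?thesis by (rule strong_integral_eq)
qed

lemma strong_integral_indicator_norm_le:
  fixes f :: "'a \<Rightarrow> 'y::banach"
  assumes B: "B \<in> sets M" "emeasure M B < \<infinity>"
    and f: "strongly_measurable M f" "AE x in M. x \<in> B \<longrightarrow> norm (f x) \<le> C" and C: "0 \<le> C"
  shows "norm (strong_integral M (\<lambda>x. indicator B x *\<^sub>R f x)) \<le> C * measure M B"
proof -
  have le: "AE x in M. norm (indicator B x *\<^sub>R f x) \<le> norm (indicator B x *\<^sub>R C)"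
    using f(2) by eventually_elim (use C in \<open>auto simp: indicator_def\<close>)
  have int: "strongly_integrable M (\<lambda>x. indicator B x *\<^sub>R f x)"
    by (rule strongly_integrable_bound[OF strongly_measurable_indicator_scaleR[OF B(1) f(1)] _ le])
      (use B in \<open>simp add: strongly_integrable_iff_integrable\<close>)
  have "ennreal (norm (strong_integral M (\<lambda>x. indicator B x *\<^sub>R f x)))
      \<le> (\<integral>\<^sup>+x. ennreal (norm (indicator B x *\<^sub>R f x)) \<partial>M)"
    by (rule strong_integral_norm_le[OF int])
  also have "\<dots> \<le> (\<integral>\<^sup>+x. ennreal C * indicator B x \<partial>M)"
    using le by (intro nn_integral_mono_AE)
      (auto elim!: eventually_mono simp: indicator_def ennreal_leI C)
  also have "\<dots> = ennreal (C * measure M B)"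
    using B C by (simp add: nn_integral_cmult_indicator emeasure_eq_ennreal_measure ennreal_mult)
  finally show ?thesis
    using C by (simp add: ennreal_le_iff)
qed

section \<open>Conditional expectation of indicators\<close>

lemma semi_finite_restr_to_subalgD:
  assumes "subalgebra M F" "semi_finite (restr_to_subalg M F)" "B \<in> sets F" "0 < emeasure M B"
  obtains C where "C \<in> sets F" "C \<subseteq> B" "0 < emeasure M C" "emeasure M C < \<infinity>"
proof -
  have "B \<in> sets (restr_to_subalg M F)" "0 < emeasure (restr_to_subalg M F) B"
    using assms by (auto simp: sets_restr_to_subalg emeasure_restr_to_subalg)
  then obtain C where "C \<in> sets (restr_to_subalg M F)" "C \<subseteq> B"
    "0 < emeasure (restr_to_subalg M F) C" "emeasure (restr_to_subalg M F) C < \<infinity>"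
    using assms(2) unfolding semi_finite_def by blast
  then show ?thesis
    using assms(1) by (intro that[of C]) (auto simp: sets_restr_to_subalg emeasure_restr_to_subalg)
qed

text \<open>The bound \<open>K\<close> enters through integrability over sets of finite measure and
  may be crude; the averages replace it by the sharp \<open>c\<close>. Since \<open>v\<close> has
  separable range, the exceptional points are covered by countably many null sets
  \<open>S y\<close>, with \<open>y\<close> in \<open>D\<close>.\<close>

lemma AE_norm_le_if_integral_le:
  fixes v :: "'a \<Rightarrow> 'y::banach"
  assumes sub: "subalgebra M F" and sf: "semi_finite (restr_to_subalg M F)"
    and v: "strongly_measurable F v" "AE x in M. norm (v x) \<le> K" and c: "0 \<le> c"
    and le: "\<And>C. C \<in> sets F \<Longrightarrow> emeasure M C < \<infinity> \<Longrightarrow>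
      norm (strong_integral M (\<lambda>x. indicator C x *\<^sub>R v x)) \<le> c * measure M C"
  shows "AE x in M. norm (v x) \<le> c"
proof -
  have FM: "sets F \<subseteq> sets M" "space F = space M"
    using sub by (auto simp: subalgebra_def)
  have vM: "strongly_measurable M v"
    by (rule strongly_measurable_subalgebra[OF sub v(1)])
  obtain D where D: "countable D" "v ` space F \<subseteq> closure D"
    by (rule strongly_measurable_separable[OF v(1)])
  \<comment> \<open>With this radius the average of \<open>v\<close> over any subset of
    \<open>S y\<close> of finite positive measure differs from \<open>y\<close> by at most half of
    \<open>norm y - c\<close>, so its norm still exceeds \<open>c\<close>.\<close>
  define S where "S y = {x \<in> space F. norm (v x - y) < (norm y - c) / 2}" for y
  have S: "S y \<in> sets F" for y
    using strongly_measurable_norm[OF strongly_measurable_diff[OF v(1) strongly_measurable_const[of F y]]]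
    unfolding S_def by measurable
  have null: "S y \<in> null_sets M" if y: "c < norm y" for y
  proof (rule ccontr)
    assume "S y \<notin> null_sets M"
    then have "0 < emeasure M (S y)"
      using S FM by (auto simp: null_sets_def zero_less_iff_neq_zero)
    then obtain C where C: "C \<in> sets F" "C \<subseteq> S y" "0 < emeasure M C" "emeasure M C < \<infinity>"
      by (rule semi_finite_restr_to_subalgD[OF sub sf S])
    have CM: "C \<in> sets M" using C FM by auto
    have int1: "strongly_integrable M (\<lambda>x. indicator C x *\<^sub>R v x)"
      by (rule strongly_integrable_indicator[OF CM C(4) vM v(2)])
    have int2: "strongly_integrable M (\<lambda>x. indicator C x *\<^sub>R y)"
      by (rule strongly_integrable_indicator[OF CM C(4) strongly_measurable_const, of _ "norm y"]) auto
    have "measure M C * norm y = norm (strong_integral M (\<lambda>x. indicator C x *\<^sub>R y))"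
      by (simp add: strong_integral_indicator[OF CM C(4)])
    also have "strong_integral M (\<lambda>x. indicator C x *\<^sub>R y) =
        strong_integral M (\<lambda>x. indicator C x *\<^sub>R v x) - strong_integral M (\<lambda>x. indicator C x *\<^sub>R (v x - y))"
      using strong_integral_diff[OF int1 int2] by (simp add: scaleR_diff_right)
    also have "norm \<dots> \<le> norm (strong_integral M (\<lambda>x. indicator C x *\<^sub>R v x)) +
        norm (strong_integral M (\<lambda>x. indicator C x *\<^sub>R (v x - y)))"
      by (rule norm_triangle_ineq4)
    also have "\<dots> \<le> c * measure M C + (norm y - c) / 2 * measure M C"
    proof (rule add_mono[OF le[OF C(1,4)]])
      show "norm (strong_integral M (\<lambda>x. indicator C x *\<^sub>R (v x - y))) \<le> (norm y - c) / 2 * measure M C"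
        using C(2) y
        by (intro strong_integral_indicator_norm_le CM C strongly_measurable_diff vM strongly_measurable_const)
          (auto simp: S_def intro!: AE_I2 less_imp_le)
    qed
    finally have "measure M C * ((norm y - c) / 2) \<le> 0"
      by (simp add: field_simps)
    moreover have "0 < measure M C"
      using C(3,4) by (simp add: measure_def enn2real_positive_iff less_top)
    ultimately show False
      using y by (simp add: mult_le_0_iff)
  qed
  have "AE x in M. \<forall>y\<in>D. c < norm y \<longrightarrow> x \<notin> S y"
    using null D(1) by (subst AE_ball_countable) (auto intro: AE_not_in)
  with AE_space show ?thesis
  proof eventually_elim
    fix x assume x: "x \<in> space M" and *: "\<forall>y\<in>D. c < norm y \<longrightarrow> x \<notin> S y"
    show "norm (v x) \<le> c"
    proof (rule ccontr)
      assume "\<not> norm (v x) \<le> c"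
      \<comment> \<open>With e = \<open>norm (v x) - c\<close>, a point \<open>y\<close> within e/4
        of \<open>v x\<close> has \<open>norm y - c\<close> above 3e/4, so the radius of
        \<open>S y\<close> is above 3e/8 and \<open>x\<close> lies in \<open>S y\<close>.\<close>
      then have "0 < (norm (v x) - c) / 4" by simp
      moreover have "v x \<in> closure D" using D(2) x FM by auto
      ultimately obtain y where y: "y \<in> D" "dist y (v x) < (norm (v x) - c) / 4"
        unfolding closure_approachable by blast
      then have "norm (v x - y) < (norm (v x) - c) / 4"
        by (simp add: dist_norm norm_minus_commute)
      moreover have "norm (v x) - norm y \<le> norm (v x - y)" by (rule norm_triangle_ineq2)
      ultimately have "c < norm y" "norm (v x - y) < (norm y - c) / 2"
        using \<open>\<not> norm (v x) \<le> c\<close> by auto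
      with * y(1) x FM show False by (auto simp: S_def)
    qed
  qed
qed

lemma AE_eq_if_integral_eq:
  fixes v w :: "'a \<Rightarrow> 'y::banach"
  assumes sub: "subalgebra M F" and sf: "semi_finite (restr_to_subalg M F)"
    and v: "strongly_measurable F v" "AE x in M. norm (v x) \<le> K"
    and w: "strongly_measurable F w" "AE x in M. norm (w x) \<le> L"
    and eq: "\<And>C. C \<in> sets F \<Longrightarrow> emeasure M C < \<infinity> \<Longrightarrow>
      strong_integral M (\<lambda>x. indicator C x *\<^sub>R v x) = strong_integral M (\<lambda>x. indicator C x *\<^sub>R w x)"
  shows "AE x in M. v x = w x"
proof -
  have "AE x in M. norm (v x - w x) \<le> 0"
  proof (rule AE_norm_le_if_integral_le[OF sub sf strongly_measurable_diff[OF v(1) w(1)]])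
    show "AE x in M. norm (v x - w x) \<le> K + L"
      using v(2) w(2) by eventually_elim (metis add_mono norm_triangle_ineq4 order_trans)
    fix C assume C: "C \<in> sets F" "emeasure M C < \<infinity>"
    then have CM: "C \<in> sets M" using sub by (auto simp: subalgebra_def)
    note int = strongly_integrable_indicator[OF CM C(2) strongly_measurable_subalgebra[OF sub]]
    show "norm (strong_integral M (\<lambda>x. indicator C x *\<^sub>R (v x - w x))) \<le> 0 * measure M C"
      using strong_integral_diff[OF int[OF v] int[OF w]] eq[OF C] by (simp add: scaleR_diff_right)
  qed simp
  then show ?thesis by (auto elim!: eventually_mono)
qed

section \<open>Local Radon-Nikodym densities and their gluing\<close>

text \<open>Restricting \<open>M\<close> to an F-set \<open>B\<close> of finite measure gives a
  finite measure, for which the conditional expectation of 1_A exists. Outside \<open>B\<close> its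
  values carry no information, hence the intersections with \<open>B\<close> everywhere. Agreement
  on overlaps is what the gluing rests on.\<close>

lemma nn_cond_exp_restrict:
  fixes M F :: "'a measure" and A :: "'a set"
  defines "h \<equiv> \<lambda>B. nn_cond_exp (density M (indicator B)) F (indicator A)"
  assumes sub: "subalgebra M F" and A: "A \<in> sets M"
  shows "h B \<in> borel_measurable F"
    and "B \<in> sets F \<Longrightarrow> emeasure M B < \<infinity> \<Longrightarrow> C \<in> sets F \<Longrightarrow>
      (\<integral>\<^sup>+x. h B x * indicator (B \<inter> C) x \<partial>M) = emeasure M (A \<inter> B \<inter> C)"
    and "B \<in> sets F \<Longrightarrow> emeasure M B < \<infinity> \<Longrightarrow> AE x in M. x \<in> B \<longrightarrow> h B x \<le> 1"
    and "B \<in> sets F \<Longrightarrow> emeasure M B < \<infinity> \<Longrightarrow> C \<in> sets F \<Longrightarrow> emeasure M C < \<infinity> \<Longrightarrow>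
      AE x in M. x \<in> B \<inter> C \<longrightarrow> h B x = h C x"
proof -
  have FM: "sets F \<subseteq> sets M" "space F = space M"
    using sub by (auto simp: subalgebra_def)
  show meas: "h B \<in> borel_measurable F" for B
    unfolding h_def by simp
  have measM: "h B \<in> borel_measurable M" for B
    by (rule measurable_from_subalg[OF sub meas])
  have fms: "finite_measure_subalgebra (density M (indicator B)) F"
    if "B \<in> sets F" "emeasure M B < \<infinity>" for B
  proof -
    have "B \<in> sets M" using that FM by auto
    then have "finite_measure (density M (indicator B))"
      using that by (intro finite_measureI) (auto simp: emeasure_density)
    moreover have "subalgebra (density M (indicator B)) F"
      using sub by (simp add: subalgebra_def)
    ultimately show ?thesis
      by (simp add: finite_measure_subalgebra_def finite_measure_subalgebra_axioms_def)
  qed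
  have dens: "(\<integral>\<^sup>+x. f x \<partial>density M (indicator B)) = (\<integral>\<^sup>+x. f x * indicator B x \<partial>M)"
    if "B \<in> sets F" "f \<in> borel_measurable M" for B f
    using that FM by (subst nn_integral_density) (auto simp: mult.commute)
  show int: "(\<integral>\<^sup>+x. h B x * indicator (B \<inter> C) x \<partial>M) = emeasure M (A \<inter> B \<inter> C)"
    if B: "B \<in> sets F" "emeasure M B < \<infinity>" and C: "C \<in> sets F" for B C
  proof -
    interpret finite_measure_subalgebra "density M (indicator B)" F by (rule fms[OF B])
    have [measurable]: "A \<in> sets M" "B \<in> sets M" "C \<in> sets M" "C \<in> sets F" "h B \<in> borel_measurable M"
      using A B C FM measM by auto
    have "(\<integral>\<^sup>+x. h B x * indicator (B \<inter> C) x \<partial>M) = (\<integral>\<^sup>+x. (indicator C x * h B x) * indicator B x \<partial>M)"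
      by (intro nn_integral_cong) (auto simp: indicator_def)
    also have "\<dots> = (\<integral>\<^sup>+x. indicator C x * h B x \<partial>density M (indicator B))"
      by (rule dens[OF B(1), symmetric]) measurable
    also have "\<dots> = (\<integral>\<^sup>+x. indicator C x * indicator A x \<partial>density M (indicator B))"
      unfolding h_def by (rule nn_cond_exp_intg) (use A in auto)
    also have "\<dots> = (\<integral>\<^sup>+x. (indicator C x * indicator A x) * indicator B x \<partial>M)"
      by (rule dens[OF B(1)]) measurable
    also have "\<dots> = (\<integral>\<^sup>+x. indicator (A \<inter> B \<inter> C) x \<partial>M)"
      by (intro nn_integral_cong) (auto simp: indicator_def)
    finally show ?thesis by simp
  qed
  show "AE x in M. x \<in> B \<longrightarrow> h B x \<le> 1" if B: "B \<in> sets F" "emeasure M B < \<infinity>"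
  proof -
    interpret finite_measure_subalgebra "density M (indicator B)" F by (rule fms[OF B])
    \<comment> \<open>Comparison with the constant 1, which is its own conditional
      expectation.\<close>
    have "AE x in density M (indicator B). h B x \<le> nn_cond_exp (density M (indicator B)) F (\<lambda>_. 1) x"
      unfolding h_def by (rule nn_cond_exp_mono) (use A in \<open>auto simp: indicator_def\<close>)
    moreover have "AE x in density M (indicator B). 1 = nn_cond_exp (density M (indicator B)) F (\<lambda>_. 1) x"
      by (rule nn_cond_exp_F_meas) simp
    ultimately have "AE x in density M (indicator B). h B x \<le> 1"
      by eventually_elim simp
    then show ?thesis
      using B FM by (subst (asm) AE_density) (auto elim!: eventually_mono simp: indicator_def)
  qed
  show "AE x in M. x \<in> B \<inter> C \<longrightarrow> h B x = h C x"
    if B: "B \<in> sets F" "emeasure M B < \<infinity>" and C: "C \<in> sets F" "emeasure M C < \<infinity>"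
  proof -
    have BC: "B \<inter> C \<in> sets F" using B C by auto
    have "emeasure M (B \<inter> C) \<le> emeasure M B" using B FM by (intro emeasure_mono) auto
    with B have BCfin: "emeasure M (B \<inter> C) < \<infinity>" by simp
    interpret finite_measure_subalgebra "density M (indicator (B \<inter> C))" F by (rule fms[OF BC BCfin])
    \<comment> \<open>Both \<open>h B\<close> and \<open>h C\<close> satisfy the identity that
      characterizes the conditional expectation for the measure restricted to
      \<open>B \<inter> C\<close>; uniqueness there identifies them. \<open>E\<close> stands for
      either of the two sets.\<close>
    have *: "AE x in density M (indicator (B \<inter> C)). h E x = h (B \<inter> C) x"
      if E: "E \<in> sets F" "emeasure M E < \<infinity>" "B \<inter> C \<subseteq> E" for E
      unfolding h_def
    proof (rule nn_cond_exp_charact)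
      fix G assume G: "G \<in> sets F"
      have [measurable]: "A \<in> sets M" "G \<in> sets M" "B \<in> sets M" "C \<in> sets M" "h E \<in> borel_measurable M"
        using A B C G FM measM by auto
      have "(\<integral>\<^sup>+x. indicator A x * indicator G x \<partial>density M (indicator (B \<inter> C)))
          = (\<integral>\<^sup>+x. (indicator A x * indicator G x) * indicator (B \<inter> C) x \<partial>M)"
        by (rule dens[OF BC]) measurable
      also have "\<dots> = (\<integral>\<^sup>+x. indicator (A \<inter> E \<inter> (B \<inter> C \<inter> G)) x \<partial>M)"
        using E(3) by (intro nn_integral_cong) (auto simp: indicator_def)
      also have "\<dots> = emeasure M (A \<inter> E \<inter> (B \<inter> C \<inter> G))"
        using E FM by (intro nn_integral_indicator) auto
      also have "\<dots> = (\<integral>\<^sup>+x. h E x * indicator (E \<inter> (B \<inter> C \<inter> G)) x \<partial>M)"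
        by (rule int[symmetric]) (use E BC G in auto)
      also have "\<dots> = (\<integral>\<^sup>+x. (h E x * indicator G x) * indicator (B \<inter> C) x \<partial>M)"
        using E(3) by (intro nn_integral_cong) (auto simp: indicator_def)
      also have "\<dots> = (\<integral>\<^sup>+x. h E x * indicator G x \<partial>density M (indicator (B \<inter> C)))"
        by (rule dens[OF BC, symmetric]) measurable
      finally show "(\<integral>\<^sup>+x. indicator A x * indicator G x \<partial>density M (indicator (B \<inter> C)))
        = (\<integral>\<^sup>+x. nn_cond_exp (density M (indicator E)) F (indicator A) x * indicator G x
            \<partial>density M (indicator (B \<inter> C)))"
        unfolding h_def .
    qed (use A meas[of E] in \<open>auto simp: h_def\<close>)
    have "AE x in density M (indicator (B \<inter> C)). h B x = h C x"
      using *[OF B] *[OF C] by (auto elim!: eventually_elim2)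
    then show ?thesis
      using BC FM by (subst (asm) AE_density) (auto elim!: eventually_mono simp: indicator_def)
  qed
qed

text \<open>A discrete layer formula: a number in [0,1] is recovered from the answers to the
  countably many questions whether \<open>q < t\<close>. A function can thus be assembled from sets,
  one for each rational level.\<close>

lemma ennreal_eq_SUP_rational_below:
  assumes "(t::ennreal) \<le> 1"
  shows "(SUP q\<in>\<rat> \<inter> {0..1::real}. ennreal q * indicator {u. ennreal q < u} t) = t"
proof (rule antisym)
  show "(SUP q\<in>\<rat> \<inter> {0..1::real}. ennreal q * indicator {u. ennreal q < u} t) \<le> t"
    by (intro SUP_least) (auto simp: indicator_def)
  show "t \<le> (SUP q\<in>\<rat> \<inter> {0..1::real}. ennreal q * indicator {u. ennreal q < u} t)"
  proof (rule dense_le)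
    fix z assume z: "z < t"
    obtain t' where t': "t = ennreal t'" "0 \<le> t'"
      using assms by (cases t) (auto simp: top_unique)
    obtain z' where z': "z = ennreal z'" "0 \<le> z'"
      using z by (cases z) auto
    have "z' < t'" using z t' z' by (simp add: ennreal_less_iff)
    then obtain q where q: "q \<in> \<rat>" "z' < q" "q < t'"
      using Rats_dense_in_real by blast
    have "q \<in> \<rat> \<inter> {0..1}" using q z' t' assms by auto
    moreover have "z \<le> ennreal q * indicator {u. ennreal q < u} t"
      using q z' t' by (simp add: ennreal_less_iff ennreal_leI)
    ultimately show "z \<le> (SUP q\<in>\<rat> \<inter> {0..1::real}. ennreal q * indicator {u. ennreal q < u} t)"
      by (rule SUP_upper2)
  qed
qed

text \<open>Two local densities agree off a null set that depends on both F-sets, and uncountably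
  many such null sets cannot be discarded at once. Essential suprema of their superlevel sets avoid
  this: agreement is claimed for one set \<open>B\<close> at a time, and for fixed \<open>B\<close>
  only countably many levels intervene.\<close>

lemma indicator_cond_exp_exists:
  assumes sub: "subalgebra M F" and mah: "maharam (restr_to_subalg M F)" and A: "A \<in> sets M"
  obtains h :: "'a \<Rightarrow> real" where "h \<in> borel_measurable F" "\<And>x. 0 \<le> h x" "\<And>x. h x \<le> 1"
    "\<And>B. B \<in> sets F \<Longrightarrow> emeasure M B < \<infinity> \<Longrightarrow>
      strong_integral M (\<lambda>x. indicator B x *\<^sub>R h x) = measure M (A \<inter> B)"
proof -
  have FM: "sets F \<subseteq> sets M" "space F = space M"
    using sub by (auto simp: subalgebra_def)
  define k where "k B = nn_cond_exp (density M (indicator B)) F (indicator A)" for B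
  note k = nn_cond_exp_restrict[OF sub A, folded k_def]
  note [measurable] = k(1)
  define L where "L q B = {x \<in> space F. ennreal q < k B x}" for q B
  have L: "L q B \<in> sets F" for q B
    unfolding L_def by measurable
  have "\<exists>H\<in>sets F. (\<forall>B\<in>sets F. emeasure M B < \<infinity> \<longrightarrow>
      (AE x in M. x \<in> B \<longrightarrow> (x \<in> H \<longleftrightarrow> ennreal q < k B x)))" for q
  proof -
    define \<E> where "\<E> = {B \<inter> L q B |B. B \<in> sets F \<and> emeasure M B < \<infinity>}"
    have "\<E> \<subseteq> sets (restr_to_subalg M F)"
      using L sub by (auto simp: \<E>_def sets_restr_to_subalg)
    then obtain H where "H \<in> sets (restr_to_subalg M F)"
      and 1: "\<forall>B\<in>\<E>. B - H \<in> null_sets (restr_to_subalg M F)"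
      and 2: "\<forall>G\<in>sets (restr_to_subalg M F). (\<forall>B\<in>\<E>. B - G \<in> null_sets (restr_to_subalg M F)) \<longrightarrow>
        H - G \<in> null_sets (restr_to_subalg M F)"
      using mah unfolding maharam_def by blast
    then have H: "H \<in> sets F" using sub by (simp add: sets_restr_to_subalg)
    show ?thesis
    proof (intro bexI[OF _ H] ballI impI)
      fix B assume B: "B \<in> sets F" "emeasure M B < \<infinity>"
      \<comment> \<open>The largest set that coincides with \<open>L q B\<close> inside
        \<open>B\<close>. It contains every member of \<E> up to a null set because the densities
        agree on overlaps, so minimality of \<open>H\<close> gives \<open>H \<subseteq> G\<close> up
        to a null set: inside \<open>B\<close>, \<open>H\<close> is no larger than the superlevel
        set.\<close>
      define G where "G = (space F - B) \<union> L q B"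
      have G: "G \<in> sets F" using B L by (auto simp: G_def)
      have "C - G \<in> null_sets (restr_to_subalg M F)" if "C \<in> \<E>" for C
      proof -
        obtain B' where B': "C = B' \<inter> L q B'" "B' \<in> sets F" "emeasure M B' < \<infinity>"
          using \<open>C \<in> \<E>\<close> by (auto simp: \<E>_def)
        have CG: "C - G \<in> sets F" using B' L G by auto
        have "AE x in M. x \<notin> C - G"
          using k(4)[OF B B'(2,3)] AE_space
          by eventually_elim (auto simp: B' G_def L_def FM)
        then have "C - G \<in> null_sets M"
          using CG FM by (subst (asm) AE_iff_null_sets[symmetric]) auto
        with CG show ?thesis by (simp add: null_sets_restr_to_subalg[OF sub])
      qed
      then have "H - G \<in> null_sets M" "B \<inter> L q B - H \<in> null_sets M"
        using 1 2 G B sub by (auto simp: null_sets_restr_to_subalg sets_restr_to_subalg \<E>_def)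
      then have "AE x in M. x \<notin> H - G" "AE x in M. x \<notin> B \<inter> L q B - H"
        using AE_not_in by blast+
      with AE_space show "AE x in M. x \<in> B \<longrightarrow> (x \<in> H \<longleftrightarrow> ennreal q < k B x)"
        by eventually_elim (auto simp: G_def L_def FM)
    qed
  qed
  then obtain H where H: "\<And>q. H q \<in> sets F" "\<And>q B. B \<in> sets F \<Longrightarrow> emeasure M B < \<infinity> \<Longrightarrow>
      AE x in M. x \<in> B \<longrightarrow> (x \<in> H q \<longleftrightarrow> ennreal q < k B x)"
    by metis
  note [measurable] = H(1)
  define Q where "Q = \<rat> \<inter> {0..1::real}"
  have Q: "countable Q" by (auto simp: Q_def intro: countable_rat)
  define h where "h x = (SUP q\<in>Q. ennreal q * indicator (H q) x)" for x
  have [measurable]: "h \<in> borel_measurable F"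
    unfolding h_def using Q by measurable
  have h1: "h x \<le> 1" for x
    unfolding h_def by (intro SUP_least) (auto simp: Q_def indicator_def)
  have hk: "AE x in M. x \<in> B \<longrightarrow> h x = k B x" if B: "B \<in> sets F" "emeasure M B < \<infinity>" for B
  proof -
    \<comment> \<open>For this single \<open>B\<close> there is one exceptional null set per level,
      hence countably many.\<close>
    have "AE x in M. \<forall>q\<in>Q. x \<in> B \<longrightarrow> (x \<in> H q \<longleftrightarrow> ennreal q < k B x)"
      using H(2)[OF B] by (subst AE_ball_countable[OF Q]) auto
    with k(3)[OF B] show ?thesis
    proof eventually_elim
      fix x assume x: "x \<in> B \<longrightarrow> k B x \<le> 1" "\<forall>q\<in>Q. x \<in> B \<longrightarrow> (x \<in> H q \<longleftrightarrow> ennreal q < k B x)"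
      show "x \<in> B \<longrightarrow> h x = k B x"
      proof
        assume "x \<in> B"
        then have "h x = (SUP q\<in>Q. ennreal q * indicator {u. ennreal q < u} (k B x))"
          using x(2) unfolding h_def by (intro SUP_cong) (auto simp: indicator_def)
        then show "h x = k B x"
          using ennreal_eq_SUP_rational_below[of "k B x"] x(1) \<open>x \<in> B\<close> by (simp add: Q_def)
      qed
    qed
  qed
  show ?thesis
  \<comment> \<open>The conversion loses nothing, since \<open>h\<close> is at most 1
    everywhere.\<close>
  proof (rule that[of "\<lambda>x. enn2real (h x)"])
    show "(\<lambda>x. enn2real (h x)) \<in> borel_measurable F" by measurable
    show "enn2real (h x) \<le> 1" for x
      using enn2real_mono[OF h1[of x]] by simp
    fix B assume B: "B \<in> sets F" "emeasure M B < \<infinity>"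
    have BM: "B \<in> sets M" using B FM by auto
    have h_eq: "ennreal (enn2real (h x)) = h x" for x
      by (rule ennreal_enn2real) (rule le_less_trans[OF h1 ennreal_one_less_top])
    have "(\<integral>\<^sup>+x. ennreal (indicator B x *\<^sub>R enn2real (h x)) \<partial>M) = (\<integral>\<^sup>+x. k B x * indicator (B \<inter> space M) x \<partial>M)"
      using hk[OF B] AE_space
      by (intro nn_integral_cong_AE) (auto elim!: eventually_elim2 simp: indicator_def h_eq)
    also have "\<dots> = emeasure M (A \<inter> B \<inter> space M)"
      using k(2)[OF B sets.top] by (simp only: FM)
    also have "A \<inter> B \<inter> space M = A \<inter> B"
      using sets.sets_into_space[OF BM] by auto
    also have "emeasure M (A \<inter> B) = ennreal (measure M (A \<inter> B))"
    proof (rule emeasure_eq_ennreal_measure)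
      have "emeasure M (A \<inter> B) \<le> emeasure M B" using BM by (intro emeasure_mono) auto
      with B(2) show "emeasure M (A \<inter> B) \<noteq> top" by auto
    qed
    finally have nn: "(\<integral>\<^sup>+x. ennreal (indicator B x *\<^sub>R enn2real (h x)) \<partial>M) = ennreal (measure M (A \<inter> B))" .
    have hM: "(\<lambda>x. enn2real (h x)) \<in> borel_measurable M"
      by (rule measurable_from_subalg[OF sub]) measurable
    have "has_bochner_integral M (\<lambda>x. indicator B x *\<^sub>R enn2real (h x)) (measure M (A \<inter> B))"
      by (rule has_bochner_integral_nn_integral[OF _ _ _ nn]) (use hM BM in auto)
    then show "strong_integral M (\<lambda>x. indicator B x *\<^sub>R enn2real (h x)) = measure M (A \<inter> B)"
      by (intro strong_integral_eq) (simp add: has_strong_integral_iff_has_bochner_integral)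
  qed simp
qed

section \<open>Conditional expectation of bounded functions\<close>

lemma strong_integral_indicator_scaleR:
  fixes h :: "'a \<Rightarrow> real" and d :: "'y::banach"
  assumes "strongly_integrable M (\<lambda>x. indicator B x *\<^sub>R h x)"
  shows "strongly_integrable M (\<lambda>x. indicator B x *\<^sub>R (h x *\<^sub>R d))"
    and "strong_integral M (\<lambda>x. indicator B x *\<^sub>R (h x *\<^sub>R d)) =
      strong_integral M (\<lambda>x. indicator B x *\<^sub>R h x) *\<^sub>R d"
  using strongly_integrable_bounded_linear[OF bounded_linear_scaleR_left assms, of d]
    strong_integral_bounded_linear[OF bounded_linear_scaleR_left assms, of d]
  by simp_all

text \<open>The series built from the scalar functions \<open>h j\<close> is bounded at first only
  by 3 C. That suffices for dominated convergence on sets of finite measure, hence for the identity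
  of integrals, and the identity in turn yields the bound C.\<close>

lemma strong_cond_exp_exists:
  fixes f :: "'a \<Rightarrow> 'y::banach"
  assumes sub: "subalgebra M F" and mah: "maharam (restr_to_subalg M F)"
    and f: "strongly_measurable M f" "AE x in M. norm (f x) \<le> C" and C: "0 \<le> C"
  obtains v where "strongly_measurable F v" "AE x in M. norm (v x) \<le> C"
    "\<And>B. B \<in> sets F \<Longrightarrow> emeasure M B < \<infinity> \<Longrightarrow>
      strong_integral M (\<lambda>x. indicator B x *\<^sub>R f x) = strong_integral M (\<lambda>x. indicator B x *\<^sub>R v x)"
proof -
  have FM: "sets F \<subseteq> sets M" "space F = space M"
    using sub by (auto simp: subalgebra_def)
  have sf: "semi_finite (restr_to_subalg M F)"
    using mah by (simp add: maharam_def)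
  \<comment> \<open>Changing \<open>f\<close> on a null set makes its bound valid everywhere, so
    that the pointwise estimate of the greedy series yields 3 C at each point.\<close>
  define S where "S = {x \<in> space M. norm (f x) \<le> C}"
  have S: "S \<in> sets M"
    using strongly_measurable_norm[OF f(1)] unfolding S_def by measurable
  define g where "g x = indicator S x *\<^sub>R f x" for x
  have g: "strongly_measurable M g"
    unfolding g_def by (rule strongly_measurable_indicator_scaleR[OF S f(1)])
  have g_le: "norm (g x) \<le> C" for x
    using C by (auto simp: g_def S_def indicator_def)
  have fg: "AE x in M. f x = g x"
    using f(2) AE_space by eventually_elim (auto simp: g_def S_def)
  obtain A :: "nat \<Rightarrow> 'a set" and d where A: "\<And>j. A j \<in> sets M"
    "\<And>n x. x \<in> space M \<Longrightarrow> (\<Sum>j<n. indicator (A j) x * norm (d j)) \<le> 3 * norm (g x)"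
    "\<And>x. x \<in> space M \<Longrightarrow> (\<lambda>j. indicator (A j) x *\<^sub>R d j) sums g x"
    by (rule strongly_measurable_series[OF g]) (rule that; assumption)
  have "\<forall>j. \<exists>h::'a \<Rightarrow> real. h \<in> borel_measurable F \<and> (\<forall>x. 0 \<le> h x) \<and> (\<forall>x. h x \<le> 1) \<and>
    (\<forall>B\<in>sets F. emeasure M B < \<infinity> \<longrightarrow>
      strong_integral M (\<lambda>x. indicator B x *\<^sub>R h x) = measure M (A j \<inter> B))"
  proof
    fix j
    show "\<exists>h::'a \<Rightarrow> real. h \<in> borel_measurable F \<and> (\<forall>x. 0 \<le> h x) \<and> (\<forall>x. h x \<le> 1) \<and>
    (\<forall>B\<in>sets F. emeasure M B < \<infinity> \<longrightarrow>
      strong_integral M (\<lambda>x. indicator B x *\<^sub>R h x) = measure M (A j \<inter> B))"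
      by (rule indicator_cond_exp_exists[OF sub mah A(1)[of j]]) blast
  qed
  then obtain h :: "nat \<Rightarrow> 'a \<Rightarrow> real" where h: "\<And>j. h j \<in> borel_measurable F"
    "\<And>j x. 0 \<le> h j x" "\<And>j x. h j x \<le> 1"
    "\<And>j B. B \<in> sets F \<Longrightarrow> emeasure M B < \<infinity> \<Longrightarrow>
      strong_integral M (\<lambda>x. indicator B x *\<^sub>R h j x) = measure M (A j \<inter> B)"
    by metis
  have hF: "strongly_measurable F (h j)" for j
    using h(1) by (simp add: strongly_measurable_iff_borel_measurable)
  have h_int: "strongly_integrable M (\<lambda>x. indicator B x *\<^sub>R h j x)"
    if "B \<in> sets F" "emeasure M B < \<infinity>" for B j
    using that FM h(2,3)
    by (intro strongly_integrable_indicator[where C=1] strongly_measurable_subalgebra[OF sub hF]) auto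
  have A_int: "strongly_integrable M (\<lambda>x. indicator B x *\<^sub>R (indicator (A j) x :: real))"
    "strong_integral M (\<lambda>x. indicator B x *\<^sub>R (indicator (A j) x :: real)) = measure M (A j \<inter> B)"
    if "B \<in> sets F" "emeasure M B < \<infinity>" for B j
  proof -
    have B: "B \<in> sets M" using that FM by auto
    show "strongly_integrable M (\<lambda>x. indicator B x *\<^sub>R (indicator (A j) x :: real))"
      using A(1) by (intro strongly_integrable_indicator[where C=1] B that strongly_measurable_indicator) auto
    have "emeasure M (A j \<inter> B) \<le> emeasure M B" using B by (intro emeasure_mono) auto
    then have "emeasure M (A j \<inter> B) < \<infinity>" using that by simp
    then show "strong_integral M (\<lambda>x. indicator B x *\<^sub>R (indicator (A j) x :: real)) = measure M (A j \<inter> B)"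
      using strong_integral_indicator[of "A j \<inter> B" M "1::real"] A(1) B
      by (simp add: indicator_inter_arith mult.commute)
  qed
  \<comment> \<open>The coefficients lie in an arbitrary Banach space, because two cases are needed:
    the numbers \<open>norm (d j)\<close> for the bound on \<open>p n\<close>, and the vectors
    \<open>d j\<close> for the integrals of \<open>s n\<close>.\<close>
  have sum_h: "strong_integral M (\<lambda>x. indicator B x *\<^sub>R (\<Sum>j<n. h j x *\<^sub>R e j)) =
      strong_integral M (\<lambda>x. indicator B x *\<^sub>R (\<Sum>j<n. indicator (A j) x *\<^sub>R e j))"
    if B: "B \<in> sets F" "emeasure M B < \<infinity>" for B n and e :: "nat \<Rightarrow> 'z::banach"
  proof -
    have "strong_integral M (\<lambda>x. indicator B x *\<^sub>R (\<Sum>j<n. k j x *\<^sub>R e j)) =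
        (\<Sum>j<n. measure M (A j \<inter> B) *\<^sub>R e j)"
      if k: "\<And>j. strongly_integrable M (\<lambda>x. indicator B x *\<^sub>R k j x)"
        "\<And>j. strong_integral M (\<lambda>x. indicator B x *\<^sub>R k j x) = measure M (A j \<inter> B)"
      for k :: "nat \<Rightarrow> 'a \<Rightarrow> real"
      unfolding scaleR_sum_right
      by (subst strong_integral_sum)
        (simp_all only: strong_integral_indicator_scaleR[OF k(1)] k(2))
    from this[OF h_int[OF B] h(4)[OF B]] this[OF A_int[OF B]] show ?thesis
      by (simp only:)
  qed
  define p where "p n x = (\<Sum>j<n. h j x * norm (d j))" for n x
  have p: "strongly_measurable F (p n)" for n
    using h(1) unfolding p_def by (simp add: strongly_measurable_iff_borel_measurable)
  have p_nonneg: "0 \<le> p n x" for n x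
    unfolding p_def using h(2) by (intro sum_nonneg mult_nonneg_nonneg) auto
  \<comment> \<open>The decisive estimate, uniform in \<open>n\<close>. Over an F-set of finite
    measure \<open>p n\<close> has the same integral as the sum of 1_(A j) |d_j|, which the greedy
    bound controls pointwise. The bound by the sum of all \<open>norm (d j)\<close> depends on
    \<open>n\<close> and only provides integrability.\<close>
  have p_le: "AE x in M. norm (p n x) \<le> 3 * C" for n
  proof (rule AE_norm_le_if_integral_le[OF sub sf p])
    show "AE x in M. norm (p n x) \<le> (\<Sum>j<n. norm (d j))"
      using p_nonneg h(3) by (auto simp: p_def intro!: AE_I2 sum_mono mult_left_le_one_le h(2))
    fix B assume B: "B \<in> sets F" "emeasure M B < \<infinity>"
    have "strong_integral M (\<lambda>x. indicator B x *\<^sub>R p n x) =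
        strong_integral M (\<lambda>x. indicator B x *\<^sub>R (\<Sum>j<n. indicator (A j) x *\<^sub>R norm (d j)))"
      using sum_h[OF B, of "\<lambda>j. norm (d j)" n] by (simp only: p_def real_scaleR_def)
    moreover have "norm (strong_integral M (\<lambda>x. indicator B x *\<^sub>R (\<Sum>j<n. indicator (A j) x *\<^sub>R norm (d j))))
        \<le> 3 * C * measure M B"
    proof (rule strong_integral_indicator_norm_le)
      show "strongly_measurable M (\<lambda>x. \<Sum>j<n. indicator (A j) x *\<^sub>R norm (d j))"
        by (intro strongly_measurable_simple simple_function_sum simple_function_indicator_scaleR A)
      show "AE x in M. x \<in> B \<longrightarrow> norm (\<Sum>j<n. indicator (A j) x *\<^sub>R norm (d j)) \<le> 3 * C"
      proof (rule AE_I2, rule impI)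
        fix x assume "x \<in> space M"
        have "norm (\<Sum>j<n. indicator (A j) x *\<^sub>R norm (d j)) = (\<Sum>j<n. indicator (A j) x * norm (d j))"
          unfolding real_norm_def real_scaleR_def by (intro abs_of_nonneg sum_nonneg) auto
        also note A(2)[OF \<open>x \<in> space M\<close>, of n]
        also have "3 * norm (g x) \<le> 3 * C" using g_le[of x] by simp
        finally show "norm (\<Sum>j<n. indicator (A j) x *\<^sub>R norm (d j)) \<le> 3 * C" .
      qed
    qed (use B FM C in auto)
    ultimately show "norm (strong_integral M (\<lambda>x. indicator B x *\<^sub>R p n x)) \<le> 3 * C * measure M B"
      by (simp only:)
  qed (use C in simp)
  \<comment> \<open>Cutting off with a conull set that belongs to \<open>F\<close> makes the series
    converge at every point without losing F-measurability of the limit.\<close>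
  define T where "T = {x \<in> space F. \<forall>n. p n x \<le> 3 * C}"
  have T: "T \<in> sets F"
    using strongly_measurable_borel[OF p] unfolding T_def by measurable
  have "AE x in M. \<forall>n. norm (p n x) \<le> 3 * C"
    using p_le by (simp add: AE_all_countable)
  with AE_space have AE_T: "AE x in M. x \<in> T"
    by eventually_elim (auto simp: T_def FM dest: order_trans[OF abs_ge_self])
  define s where "s n x = indicator T x *\<^sub>R (\<Sum>j<n. h j x *\<^sub>R d j)" for n x
  define v where "v x = indicator T x *\<^sub>R (\<Sum>j. h j x *\<^sub>R d j)" for x
  have s: "strongly_measurable F (s n)" for n
    unfolding s_def
    by (intro strongly_measurable_indicator_scaleR[OF T] strongly_measurable_sum
        strongly_measurable_scaleR hF strongly_measurable_const)
  have norm_term: "norm (h j x *\<^sub>R d j) = h j x * norm (d j)" for j x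
    using h(2)[of j x] by simp
  have s_le: "norm (s n x) \<le> 3 * C" for n x
  proof (cases "x \<in> T")
    case True
    have "norm (s n x) \<le> (\<Sum>j<n. norm (h j x *\<^sub>R d j))"
      using True by (simp add: s_def) (metis (no_types, lifting) norm_sum norm_scaleR sum.cong)
    also have "\<dots> = p n x" by (simp only: p_def norm_term)
    finally show ?thesis using True by (auto simp: T_def intro: order_trans)
  qed (use C in \<open>simp add: s_def\<close>)
  have s_lim: "(\<lambda>n. s n x) \<longlonglongrightarrow> v x" for x
  proof (cases "x \<in> T")
    case True
    then have "summable (\<lambda>j. norm (h j x *\<^sub>R d j))"
      unfolding norm_term using h(2)
      by (intro summableI_nonneg_bounded[where x="3 * C"]) (auto simp: T_def p_def)
    from summable_LIMSEQ[OF summable_norm_cancel[OF this]] show ?thesis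
      using True by (simp add: s_def v_def)
  qed (simp add: s_def v_def)
  have v: "strongly_measurable F v"
    by (rule strongly_measurable_LIMSEQ[OF s s_lim])
  have int_eq: "strong_integral M (\<lambda>x. indicator B x *\<^sub>R f x) = strong_integral M (\<lambda>x. indicator B x *\<^sub>R v x)"
    if B: "B \<in> sets F" "emeasure M B < \<infinity>" for B
  proof -
    have BM: "B \<in> sets M" using B FM by auto
    \<comment> \<open>A common majorant for both kinds of partial sums, integrable because
      \<open>B\<close> has finite measure. The integrals of the partial sums agree for each
      \<open>n\<close>, hence so do those of the limits \<open>v\<close> and
      \<open>g\<close>.\<close>
    have w: "strongly_integrable M (\<lambda>x. indicator B x *\<^sub>R (3 * C))"
      using BM B(2) C by (intro strongly_integrable_indicator[where C="3 * C"] strongly_measurable_const) auto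
    have 1: "(\<lambda>n. strong_integral M (\<lambda>x. indicator B x *\<^sub>R s n x)) \<longlonglongrightarrow>
        strong_integral M (\<lambda>x. indicator B x *\<^sub>R v x)"
      by (intro strong_integral_dominated_convergence[OF _ _ w] strongly_measurable_indicator_scaleR BM
          strongly_measurable_subalgebra[OF sub v] strongly_measurable_subalgebra[OF sub s])
        (use s_le s_lim C in \<open>auto intro!: AE_I2 tendsto_intros simp: indicator_def\<close>)
    have a: "strongly_measurable M (\<lambda>x. \<Sum>j<n. indicator (A j) x *\<^sub>R d j)" for n
      by (intro strongly_measurable_simple simple_function_sum simple_function_indicator_scaleR A)
    have a_le: "norm (\<Sum>j<n. indicator (A j) x *\<^sub>R d j) \<le> 3 * C" if "x \<in> space M" for n x
    proof -
      have "norm (\<Sum>j<n. indicator (A j) x *\<^sub>R d j) \<le> (\<Sum>j<n. norm (indicator (A j) x *\<^sub>R d j))"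
        by (rule norm_sum)
      also have "\<dots> = (\<Sum>j<n. indicator (A j) x * norm (d j))"
        by (intro sum.cong) (auto simp: indicator_def)
      also note A(2)[OF that, of n]
      also have "3 * norm (g x) \<le> 3 * C" using g_le[of x] by simp
      finally show ?thesis .
    qed
    have 2: "(\<lambda>n. strong_integral M (\<lambda>x. indicator B x *\<^sub>R (\<Sum>j<n. indicator (A j) x *\<^sub>R d j))) \<longlonglongrightarrow>
        strong_integral M (\<lambda>x. indicator B x *\<^sub>R g x)"
    proof (intro strong_integral_dominated_convergence[OF _ _ w] strongly_measurable_indicator_scaleR BM g a)
      show "AE x in M. (\<lambda>n. indicator B x *\<^sub>R (\<Sum>j<n. indicator (A j) x *\<^sub>R d j)) \<longlonglongrightarrow> indicator B x *\<^sub>R g x"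
        using A(3) by (intro AE_I2 tendsto_intros) (simp only: sums_def)
      show "AE x in M. norm (indicator B x *\<^sub>R (\<Sum>j<n. indicator (A j) x *\<^sub>R d j)) \<le> indicator B x *\<^sub>R (3 * C)" for n
      proof (rule AE_I2)
        fix x assume "x \<in> space M"
        from a_le[OF this, of n]
        show "norm (indicator B x *\<^sub>R (\<Sum>j<n. indicator (A j) x *\<^sub>R d j)) \<le> indicator B x *\<^sub>R (3 * C)"
          by (cases "x \<in> B") (simp_all only: simp_thms indicator_simps scaleR_one scaleR_zero_left norm_zero order_refl)
      qed
    qed
    have "strong_integral M (\<lambda>x. indicator B x *\<^sub>R s n x) =
        strong_integral M (\<lambda>x. indicator B x *\<^sub>R (\<Sum>j<n. indicator (A j) x *\<^sub>R d j))" for n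
    proof -
      have si: "strongly_integrable M (\<lambda>x. indicator B x *\<^sub>R s n x)"
        by (rule strongly_integrable_indicator[OF BM B(2) strongly_measurable_subalgebra[OF sub s], of _ "3 * C"])
          (use s_le in auto)
      have "strong_integral M (\<lambda>x. indicator B x *\<^sub>R s n x) =
          strong_integral M (\<lambda>x. indicator B x *\<^sub>R (\<Sum>j<n. h j x *\<^sub>R d j))"
      proof (rule strong_integral_cong_AE(2)[OF si])
        show "strongly_measurable M (\<lambda>x. indicator B x *\<^sub>R (\<Sum>j<n. h j x *\<^sub>R d j))"
          by (intro strongly_measurable_indicator_scaleR[OF BM] strongly_measurable_sum
              strongly_measurable_scaleR strongly_measurable_subalgebra[OF sub hF] strongly_measurable_const)
        show "AE x in M. indicator B x *\<^sub>R s n x = indicator B x *\<^sub>R (\<Sum>j<n. h j x *\<^sub>R d j)"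
          using AE_T by eventually_elim (simp add: s_def)
      qed
      then show ?thesis by (simp only: sum_h[OF B])
    qed
    with 1 2 have "strong_integral M (\<lambda>x. indicator B x *\<^sub>R v x) = strong_integral M (\<lambda>x. indicator B x *\<^sub>R g x)"
      using LIMSEQ_unique by auto
    moreover have "strong_integral M (\<lambda>x. indicator B x *\<^sub>R f x) = strong_integral M (\<lambda>x. indicator B x *\<^sub>R g x)"
      by (rule strong_integral_cong_AE(2)[OF strongly_integrable_indicator[OF BM B(2) f]
            strongly_measurable_indicator_scaleR[OF BM g]])
        (use fg in \<open>auto elim!: eventually_mono\<close>)
    ultimately show ?thesis by simp
  qed
  show ?thesis
  proof (rule that[OF v _ int_eq])
    show "AE x in M. norm (v x) \<le> C"
    \<comment> \<open>Here 3 C is sharpened to C: the integrals of \<open>v\<close> over F-sets are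
      those of \<open>f\<close>, which is bounded by C.\<close>
    proof (rule AE_norm_le_if_integral_le[OF sub sf v])
      show "AE x in M. norm (v x) \<le> 3 * C"
        using s_le by (intro AE_I2 LIMSEQ_le_const2[OF tendsto_norm[OF s_lim]]) auto
      fix B assume B: "B \<in> sets F" "emeasure M B < \<infinity>"
      then have "B \<in> sets M" using FM by auto
      then show "norm (strong_integral M (\<lambda>x. indicator B x *\<^sub>R v x)) \<le> C * measure M B"
        unfolding int_eq[OF B, symmetric]
        by (rule strong_integral_indicator_norm_le[OF _ B(2) f(1) _ C])
          (use f(2) in \<open>auto elim!: eventually_mono\<close>)
    qed (rule C)
  qed
qed

section \<open>Integrals of bilinear pairings\<close>

lemma strongly_integrable_norm_mult:
  assumes f: "strongly_integrable M f" and g: "strongly_measurable M g" "AE x in M. norm (g x) \<le> K"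
  shows "strongly_integrable M (\<lambda>x. norm (f x) * norm (g x))"
proof (rule strongly_integrable_bound)
  note f' = strongly_integrableD[OF f]
  show "strongly_measurable M (\<lambda>x. norm (f x) * norm (g x))"
    using strongly_measurable_norm[OF f'(1)] strongly_measurable_norm[OF g(1)]
    by (simp add: strongly_measurable_iff_borel_measurable)
  show "strongly_integrable M (\<lambda>x. K *\<^sub>R f x)"
    by (rule strongly_integrable_bounded_linear[OF bounded_linear_scaleR_right f])
  show "AE x in M. norm (norm (f x) * norm (g x)) \<le> norm (K *\<^sub>R f x)"
    using g(2)
  proof eventually_elim
    fix x assume "norm (g x) \<le> K"
    then have "norm (f x) * norm (g x) \<le> \<bar>K\<bar> * norm (f x)"
      using mult_left_mono[of "norm (g x)" "\<bar>K\<bar>" "norm (f x)"] by (simp add: mult.commute)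
    then show "norm (norm (f x) * norm (g x)) \<le> norm (K *\<^sub>R f x)" by simp
  qed
qed

text \<open>In the greedy series of \<open>r\<close> the sets lie in \<open>F\<close>, and pairing
  with a fixed vector \<open>d j\<close> is a bounded linear map that leaves the integral over
  \<open>A j\<close>. The hypothesis \<open>eq\<close> is restricted to F-sets on which
  \<open>norm (r x)\<close> is bounded below. This form fits both uses: for an integrable
  \<open>r\<close> such sets have finite measure, and for a bounded \<open>r\<close> the other
  factors are integrable over all F-sets.\<close>

lemma strong_integral_bilinear_eq:
  fixes r :: "'a \<Rightarrow> 'p::banach" and a b :: "'a \<Rightarrow> 'q::banach" and pair :: "'p \<Rightarrow> 'q \<Rightarrow> 'r::banach"
  assumes pair: "bounded_bilinear pair" and sub: "subalgebra M F"
    and r: "strongly_measurable F r"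
    and a: "strongly_measurable M a" "strongly_integrable M (\<lambda>x. norm (r x) * norm (a x))"
    and b: "strongly_measurable M b" "strongly_integrable M (\<lambda>x. norm (r x) * norm (b x))"
    and eq: "\<And>B. B \<in> sets F \<Longrightarrow> \<exists>c>0. \<forall>x\<in>B. c \<le> norm (r x) \<Longrightarrow>
      strongly_integrable M (\<lambda>x. indicator B x *\<^sub>R a x) \<and>
      strongly_integrable M (\<lambda>x. indicator B x *\<^sub>R b x) \<and>
      strong_integral M (\<lambda>x. indicator B x *\<^sub>R a x) = strong_integral M (\<lambda>x. indicator B x *\<^sub>R b x)"
  shows "strongly_integrable M (\<lambda>x. pair (r x) (a x))"
    and "strongly_integrable M (\<lambda>x. pair (r x) (b x))"
    and "strong_integral M (\<lambda>x. pair (r x) (a x)) = strong_integral M (\<lambda>x. pair (r x) (b x))"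
proof -
  interpret pair: bounded_bilinear pair by fact
  have FM: "sets F \<subseteq> sets M" "space F = space M"
    using sub by (auto simp: subalgebra_def)
  have rM: "strongly_measurable M r" by (rule strongly_measurable_subalgebra[OF sub r])
  obtain K where K: "K > 0" "\<And>x y. norm (pair x y) \<le> norm x * norm y * K"
    using pair.pos_bounded by blast
  obtain A :: "nat \<Rightarrow> 'a set" and d where A: "\<And>j. A j \<in> sets F"
    "\<And>n x. x \<in> space F \<Longrightarrow> (\<Sum>j<n. indicator (A j) x * norm (d j)) \<le> 3 * norm (r x)"
    "\<And>x. x \<in> space F \<Longrightarrow> (\<lambda>j. indicator (A j) x *\<^sub>R d j) sums r x"
    by (rule strongly_measurable_series[OF r]) (rule that; assumption)
  have AM: "A j \<in> sets M" for j using A(1) FM by auto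
  define s where "s n x = (\<Sum>j<n. indicator (A j) x *\<^sub>R d j)" for n x
  have s: "strongly_measurable M (s n)" for n
    unfolding s_def by (intro strongly_measurable_simple simple_function_sum simple_function_indicator_scaleR AM)
  have s_le: "norm (s n x) \<le> 3 * norm (r x)" if "x \<in> space M" for n x
  proof -
    have "norm (s n x) \<le> (\<Sum>j<n. norm (indicator (A j) x *\<^sub>R d j))"
      unfolding s_def by (rule norm_sum)
    also have "\<dots> = (\<Sum>j<n. indicator (A j) x * norm (d j))"
      by (intro sum.cong) (auto simp: indicator_def)
    finally show ?thesis using A(2)[of x n] that FM by auto
  qed
  \<comment> \<open>A single term is at most the partial sum that ends with it, and this is at most
    \<open>3 * norm (r x)\<close>.\<close>
  have d_le: "norm (d j) / 3 \<le> norm (r x)" if "x \<in> A j" for j x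
  proof -
    have x: "x \<in> space F" using that A(1) sets.sets_into_space by blast
    have "norm (d j) \<le> (\<Sum>i<Suc j. indicator (A i) x * norm (d i))"
      using that sum_nonneg[of "{..<j}" "\<lambda>i. indicator (A i) x * norm (d i)"] by simp
    with A(2)[OF x, of "Suc j"] show ?thesis by simp
  qed
  have lim: "strongly_integrable M (\<lambda>x. pair (r x) (c x)) \<and>
      (\<lambda>n. strong_integral M (\<lambda>x. pair (s n x) (c x))) \<longlonglongrightarrow> strong_integral M (\<lambda>x. pair (r x) (c x))"
    if c: "strongly_measurable M c" "strongly_integrable M (\<lambda>x. norm (r x) * norm (c x))" for c
  proof
    have w: "strongly_integrable M (\<lambda>x. 3 * K * (norm (r x) * norm (c x)))"
      by (rule strongly_integrable_bounded_linear[OF bounded_linear_mult_right c(2)])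
    have le: "norm (pair y (c x)) \<le> 3 * K * (norm (r x) * norm (c x))" if "norm y \<le> 3 * norm (r x)" for x y
    proof -
      have "norm (pair y (c x)) \<le> norm y * norm (c x) * K" by (rule K(2))
      also have "\<dots> \<le> (3 * norm (r x)) * norm (c x) * K"
        using that K(1) by (intro mult_right_mono) auto
      finally show ?thesis by (simp add: mult_ac)
    qed
    show "strongly_integrable M (\<lambda>x. pair (r x) (c x))"
      by (rule strongly_integrable_bound[OF strongly_measurable_bilinear[OF pair rM c(1)] w])
        (intro AE_I2, unfold real_norm_def, intro order_trans[OF le abs_ge_self], simp)
    show "(\<lambda>n. strong_integral M (\<lambda>x. pair (s n x) (c x))) \<longlonglongrightarrow> strong_integral M (\<lambda>x. pair (r x) (c x))"
    proof (rule strong_integral_dominated_convergence[OF strongly_measurable_bilinear[OF pair rM c(1)]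
          strongly_measurable_bilinear[OF pair s c(1)] w])
      show "AE x in M. (\<lambda>n. pair (s n x) (c x)) \<longlonglongrightarrow> pair (r x) (c x)"
        using A(3) FM by (intro AE_I2 pair.tendsto tendsto_const) (simp add: sums_def s_def)
      show "AE x in M. norm (pair (s n x) (c x)) \<le> 3 * K * (norm (r x) * norm (c x))" for n
        by (intro AE_I2 le s_le)
    qed
  qed
  have summand: "strongly_integrable M (\<lambda>x. pair (indicator (A j) x *\<^sub>R d j) (a x)) \<and>
    strongly_integrable M (\<lambda>x. pair (indicator (A j) x *\<^sub>R d j) (b x)) \<and>
    strong_integral M (\<lambda>x. pair (indicator (A j) x *\<^sub>R d j) (a x)) =
    strong_integral M (\<lambda>x. pair (indicator (A j) x *\<^sub>R d j) (b x))" for j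
  \<comment> \<open>A zero vector gives no positive lower bound on \<open>A j\<close>, but its term
    vanishes.\<close>
  proof (cases "d j = 0")
    case True
    then show ?thesis by (simp add: pair.zero_left strongly_integrable_zero)
  next
    case False
    then have "\<exists>c>0. \<forall>x\<in>A j. c \<le> norm (r x)"
      using d_le by (intro exI[of _ "norm (d j) / 3"]) auto
    from eq[OF A(1) this] have e: "strongly_integrable M (\<lambda>x. indicator (A j) x *\<^sub>R a x)"
      "strongly_integrable M (\<lambda>x. indicator (A j) x *\<^sub>R b x)"
      "strong_integral M (\<lambda>x. indicator (A j) x *\<^sub>R a x) = strong_integral M (\<lambda>x. indicator (A j) x *\<^sub>R b x)"
      by auto
    \<comment> \<open>The indicator moves to the other factor, which turns the term into an integral
      of that factor over \<open>A j\<close>.\<close>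
    have *: "pair (indicator (A j) x *\<^sub>R d j) y = pair (d j) (indicator (A j) x *\<^sub>R y)" for x y
      by (simp add: pair.scaleR_left pair.scaleR_right)
    have lin: "bounded_linear (pair (d j))" by (rule pair.bounded_linear_right)
    show ?thesis
      unfolding * using strongly_integrable_bounded_linear[OF lin e(1)]
        strongly_integrable_bounded_linear[OF lin e(2)] strong_integral_bounded_linear[OF lin e(1)]
        strong_integral_bounded_linear[OF lin e(2)] e(3) by simp
  qed
  have "strong_integral M (\<lambda>x. pair (s n x) (a x)) = strong_integral M (\<lambda>x. pair (s n x) (b x))" for n
    unfolding s_def pair.sum_left using summand by (subst (1 2) strong_integral_sum) auto
  then show "strong_integral M (\<lambda>x. pair (r x) (a x)) = strong_integral M (\<lambda>x. pair (r x) (b x))"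
    using lim[OF a] lim[OF b] LIMSEQ_unique by auto
  show "strongly_integrable M (\<lambda>x. pair (r x) (a x))" "strongly_integrable M (\<lambda>x. pair (r x) (b x))"
    using lim[OF a] lim[OF b] by auto
qed

section \<open>Classes and the duality formula\<close>

lemma Lp_norm_cong_AE:
  assumes "AE x in M. f x = g x" "strongly_measurable M f" "strongly_measurable M g"
  shows "Lp_norm p M f = Lp_norm p M g"
proof -
  have "(\<integral>\<^sup>+x. ennreal (norm (f x) powr enn2real p) \<partial>M) = (\<integral>\<^sup>+x. ennreal (norm (g x) powr enn2real p) \<partial>M)"
    using assms(1) by (intro nn_integral_cong_AE) (auto elim!: eventually_mono)
  moreover have "esssup M (\<lambda>x. ennreal (norm (f x))) = esssup M (\<lambda>x. ennreal (norm (g x)))"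
    using assms(1) strongly_measurable_ennreal_norm[OF assms(2)] strongly_measurable_ennreal_norm[OF assms(3)]
    by (intro esssup_AE_cong) (auto elim!: eventually_mono)
  ultimately show ?thesis by (simp add: Lp_norm_def)
qed

lemma Lp_norm_infinity_le_iff:
  assumes "strongly_measurable M f"
  shows "Lp_norm \<infinity> M f \<le> c \<longleftrightarrow> (AE x in M. ennreal (norm (f x)) \<le> c)"
proof
  assume le: "Lp_norm \<infinity> M f \<le> c"
  have "AE x in M. ennreal (norm (f x)) \<le> Lp_norm \<infinity> M f"
    unfolding Lp_norm_def by (simp add: esssup_AE)
  then show "AE x in M. ennreal (norm (f x)) \<le> c"
    by eventually_elim (rule order_trans[OF _ le])
next
  assume "AE x in M. ennreal (norm (f x)) \<le> c"
  then show "Lp_norm \<infinity> M f \<le> c"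
    unfolding Lp_norm_def using strongly_measurable_ennreal_norm[OF assms] by (simp add: esssup_I)
qed

lemma Lp_norm_infinity_finite:
  assumes "strongly_measurable M f"
  shows "Lp_norm \<infinity> M f < \<infinity> \<longleftrightarrow> (\<exists>C. AE x in M. norm (f x) \<le> C)"
proof
  assume "Lp_norm \<infinity> M f < \<infinity>"
  then obtain C where "0 \<le> C" "Lp_norm \<infinity> M f = ennreal C"
    by (cases "Lp_norm \<infinity> M f") auto
  then have "AE x in M. ennreal (norm (f x)) \<le> ennreal C"
    using Lp_norm_infinity_le_iff[OF assms, of "ennreal C"] by simp
  then show "\<exists>C. AE x in M. norm (f x) \<le> C"
    using \<open>0 \<le> C\<close> by (auto simp: ennreal_le_iff)
next
  assume "\<exists>C. AE x in M. norm (f x) \<le> C"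
  then obtain C where "AE x in M. norm (f x) \<le> C" by blast
  then have "Lp_norm \<infinity> M f \<le> ennreal C"
    unfolding Lp_norm_infinity_le_iff[OF assms] by (auto elim!: eventually_mono intro: ennreal_leI)
  then show "Lp_norm \<infinity> M f < \<infinity>"
    using ennreal_less_top order.strict_trans1 infinity_ennreal_def by metis
qed

lemma Lp_norm_1_finite:
  "Lp_norm 1 M f < \<infinity> \<longleftrightarrow> (\<integral>\<^sup>+x. ennreal (norm (f x)) \<partial>M) < \<infinity>"
  by (auto simp: Lp_norm_def Let_def less_top)

lemma ae_class_eqI:
  assumes "AE x in M. f x = g x"
  shows "ae_class M f = ae_class M g"
proof -
  have "(AE x in M. k x = f x) \<longleftrightarrow> (AE x in M. k x = g x)" for k
    using assms by (auto elim: eventually_elim2)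
  then show ?thesis by (simp add: ae_class_def)
qed

lemma rep_ae_class:
  assumes "strongly_measurable M f"
  shows "strongly_measurable M (rep (ae_class M f))" "AE x in M. rep (ae_class M f) x = f x"
proof -
  have "f \<in> ae_class M f" using assms by (simp add: ae_class_def)
  then have "rep (ae_class M f) \<in> ae_class M f"
    unfolding rep_def by (rule someI[of "\<lambda>k. k \<in> ae_class M f"])
  then show "strongly_measurable M (rep (ae_class M f))" "AE x in M. rep (ae_class M f) x = f x"
    by (auto simp: ae_class_def)
qed

lemma ae_class_in_Lp:
  "strongly_measurable M f \<Longrightarrow> Lp_norm p M f < \<infinity> \<Longrightarrow> ae_class M f \<in> Lp p M"
  by (auto simp: Lp_def)

lemma class_norm_ae_class:
  "strongly_measurable M f \<Longrightarrow> class_norm p M (ae_class M f) = Lp_norm p M f"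
  unfolding class_norm_def by (intro Lp_norm_cong_AE rep_ae_class)

lemma rep_Lp:
  assumes "u \<in> Lp p M"
  shows "strongly_measurable M (rep u)" "ae_class M (rep u) = u" "Lp_norm p M (rep u) < \<infinity>"
proof -
  obtain f where f: "strongly_measurable M f" "Lp_norm p M f < \<infinity>" "u = ae_class M f"
    using assms by (auto simp: Lp_def)
  note r = rep_ae_class[OF f(1), folded f(3)]
  show "strongly_measurable M (rep u)" by (rule r(1))
  show "ae_class M (rep u) = u" using ae_class_eqI[OF r(2)] f(3) by simp
  show "Lp_norm p M (rep u) < \<infinity>" using Lp_norm_cong_AE[OF r(2,1) f(1)] f(2) by simp
qed

lemma rep_Linf_bounded:
  assumes "u \<in> Lp \<infinity> M"
  obtains C where "AE x in M. norm (rep u x) \<le> C"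
  using rep_Lp[OF assms] Lp_norm_infinity_finite by blast

lemma Lp_subI:
  assumes "subalgebra M F" "strongly_measurable F v" "Lp_norm p M v < \<infinity>"
  shows "ae_class M v \<in> Lp_sub p M F"
proof -
  have "strongly_measurable M v" by (rule strongly_measurable_subalgebra[OF assms(1,2)])
  then have "ae_class M v \<in> Lp p M" "v \<in> ae_class M v"
    using assms(3) by (auto simp: ae_class_in_Lp) (simp add: ae_class_def)
  with assms(2) show ?thesis unfolding Lp_sub_def by blast
qed

text \<open>The chosen representative \<open>rep w\<close> is only known to be strongly measurable
  with respect to \<open>M\<close>. Arguments that need F-measurability use this \<open>v\<close>
  and return to \<open>rep w\<close> by equality almost everywhere.\<close>

lemma Lp_subE:
  assumes "subalgebra M F" "w \<in> Lp_sub p M F"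
  obtains v where "strongly_measurable F v" "strongly_measurable M v" "w = ae_class M v"
    "AE x in M. rep w x = v x" "Lp_norm p M v < \<infinity>"
proof -
  obtain v where v: "w \<in> Lp p M" "v \<in> w" "strongly_measurable F v"
    using assms(2) by (auto simp: Lp_sub_def)
  note r = rep_Lp[OF v(1)]
  have "v \<in> ae_class M (rep w)" using v(2) r(2) by simp
  then have vM: "strongly_measurable M v" and eq: "AE x in M. v x = rep w x"
    by (auto simp: ae_class_def)
  show ?thesis
  proof (rule that[OF v(3) vM])
    show "w = ae_class M v" using ae_class_eqI[OF eq] r(2) by simp
    show "AE x in M. rep w x = v x" using eq by (auto elim!: eventually_mono)
    show "Lp_norm p M v < \<infinity>" using Lp_norm_cong_AE[OF eq vM r(1)] r(3) by simp
  qed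
qed

lemma Lp_sub_subset_Lp: "Lp_sub p M F \<subseteq> Lp p M"
  by (auto simp: Lp_sub_def)

lemma class_integral_eq:
  fixes f :: "'a \<Rightarrow> 'y::banach"
  assumes B: "B \<in> sets M" and f: "strongly_measurable M f" "strongly_integrable M (\<lambda>x. indicator B x *\<^sub>R f x)"
    and u: "strongly_measurable M (rep u)" "AE x in M. rep u x = f x"
  shows "class_integral M B u = strong_integral M (\<lambda>x. indicator B x *\<^sub>R f x)"
  unfolding class_integral_def
  by (rule strong_integral_cong_AE(2)[OF f(2), symmetric])
    (use u B in \<open>auto intro!: strongly_measurable_indicator_scaleR elim!: eventually_mono\<close>)

lemma class_integral_ae_class:
  fixes f :: "'a \<Rightarrow> 'y::banach"
  assumes B: "B \<in> sets M" "emeasure M B < \<infinity>"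
    and f: "strongly_measurable M f" "AE x in M. norm (f x) \<le> C"
  shows "class_integral M B (ae_class M f) = strong_integral M (\<lambda>x. indicator B x *\<^sub>R f x)"
  by (rule class_integral_eq[OF B(1) f(1) strongly_integrable_indicator[OF B f] rep_ae_class[OF f(1)]])

text \<open>The integral knows only real scalars. Real homogeneity of \<open>smul c\<close> holds
  because real multiples are also given by \<open>smul\<close> and scalars in \<open>'k\<close>
  commute.\<close>

lemma banach_over_bounded_linear:
  assumes "banach_over smul"
  shows "bounded_linear (smul c)"
proof -
  interpret banach_over smul by fact
  show ?thesis
  proof (rule bounded_linear_intro)
    show "smul c (x + y) = smul c x + smul c y" for x y
      by (rule scale_right_distrib)
    show "smul c (r *\<^sub>R x) = r *\<^sub>R smul c x" for r x
      by (simp add: smul_of_real[symmetric] scale_left_commute)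
    show "norm (smul c x) \<le> norm x * norm c" for x
      by (simp add: norm_smul mult.commute)
  qed
qed

section \<open>The conditional expectation on classes\<close>

lemma cond_exp_class_exists:
  fixes u :: "('a \<Rightarrow> 'y::banach) set"
  assumes sub: "subalgebra M F" and mah: "maharam (restr_to_subalg M F)" and u: "u \<in> Lp \<infinity> M"
  obtains w where "w \<in> Lp_sub \<infinity> M F" "class_norm \<infinity> M w \<le> class_norm \<infinity> M u"
    "\<And>B. B \<in> sets F \<Longrightarrow> emeasure M B < \<infinity> \<Longrightarrow> class_integral M B u = class_integral M B w"
proof -
  note r = rep_Lp[OF u]
  \<comment> \<open>Taking for C the essential norm of \<open>u\<close> itself makes the bound on
    \<open>v\<close> the contractivity estimate.\<close>
  obtain C where C: "0 \<le> C" "Lp_norm \<infinity> M (rep u) = ennreal C"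
    using r(3) by (cases "Lp_norm \<infinity> M (rep u)") auto
  then have bd: "AE x in M. norm (rep u x) \<le> C"
    using Lp_norm_infinity_le_iff[OF r(1), of "ennreal C"] by (simp add: ennreal_le_iff)
  obtain v where v: "strongly_measurable F v" "AE x in M. norm (v x) \<le> C"
    "\<And>B. B \<in> sets F \<Longrightarrow> emeasure M B < \<infinity> \<Longrightarrow>
      strong_integral M (\<lambda>x. indicator B x *\<^sub>R rep u x) = strong_integral M (\<lambda>x. indicator B x *\<^sub>R v x)"
    by (rule strong_cond_exp_exists[OF sub mah r(1) bd C(1)]) (rule that; assumption)
  have vM: "strongly_measurable M v" by (rule strongly_measurable_subalgebra[OF sub v(1)])
  have le: "Lp_norm \<infinity> M v \<le> ennreal C"
    unfolding Lp_norm_infinity_le_iff[OF vM] using v(2) by (auto elim!: eventually_mono intro: ennreal_leI)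
  show ?thesis
  proof (rule that[of "ae_class M v"])
    show "ae_class M v \<in> Lp_sub \<infinity> M F"
      using le by (intro Lp_subI sub v) (auto intro: order.strict_trans1)
    show "class_norm \<infinity> M (ae_class M v) \<le> class_norm \<infinity> M u"
      unfolding class_norm_ae_class[OF vM] using le C by (simp add: class_norm_def)
    fix B assume B: "B \<in> sets F" "emeasure M B < \<infinity>"
    then have BM: "B \<in> sets M" using sub by (auto simp: subalgebra_def)
    show "class_integral M B u = class_integral M B (ae_class M v)"
      unfolding class_integral_ae_class[OF BM B(2) vM v(2)] using v(3)[OF B]
      by (simp add: class_integral_def)
  qed
qed

lemma cond_exp_class_unique:
  fixes w w' :: "('a \<Rightarrow> 'y::banach) set"
  assumes sub: "subalgebra M F" and sf: "semi_finite (restr_to_subalg M F)"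
    and w: "w \<in> Lp_sub \<infinity> M F" and w': "w' \<in> Lp_sub \<infinity> M F"
    and eq: "\<And>B. B \<in> sets F \<Longrightarrow> emeasure M B < \<infinity> \<Longrightarrow> class_integral M B w = class_integral M B w'"
  shows "w = w'"
proof -
  obtain v where v: "strongly_measurable F v" "strongly_measurable M v" "w = ae_class M v" "Lp_norm \<infinity> M v < \<infinity>"
    using Lp_subE[OF sub w] by metis
  obtain v' where v': "strongly_measurable F v'" "strongly_measurable M v'" "w' = ae_class M v'" "Lp_norm \<infinity> M v' < \<infinity>"
    using Lp_subE[OF sub w'] by metis
  obtain C where C: "AE x in M. norm (v x) \<le> C"
    using v Lp_norm_infinity_finite by blast
  obtain C' where C': "AE x in M. norm (v' x) \<le> C'"
    using v' Lp_norm_infinity_finite by blast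
  have "AE x in M. v x = v' x"
  proof (rule AE_eq_if_integral_eq[OF sub sf v(1) C v'(1) C'])
    fix B assume B: "B \<in> sets F" "emeasure M B < \<infinity>"
    then have BM: "B \<in> sets M" using sub by (auto simp: subalgebra_def)
    show "strong_integral M (\<lambda>x. indicator B x *\<^sub>R v x) = strong_integral M (\<lambda>x. indicator B x *\<^sub>R v' x)"
      using eq[OF B] class_integral_ae_class[OF BM B(2) v(2) C] class_integral_ae_class[OF BM B(2) v'(2) C'] v(3) v'(3)
      by simp
  qed
  then show ?thesis unfolding v(3) v'(3) by (rule ae_class_eqI)
qed

text \<open>What the uniqueness argument needs to give additivity: the sum of classes is compatible
  with integrals and stays among the classes with an F-measurable representative.\<close>

lemma Linf_add:
  fixes u v :: "('a \<Rightarrow> 'y::banach) set"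
  assumes u: "u \<in> Lp \<infinity> M" and v: "v \<in> Lp \<infinity> M"
  shows "class_add M u v \<in> Lp \<infinity> M"
    and "B \<in> sets M \<Longrightarrow> emeasure M B < \<infinity> \<Longrightarrow>
      class_integral M B (class_add M u v) = class_integral M B u + class_integral M B v"
    and "subalgebra M F \<Longrightarrow> u \<in> Lp_sub \<infinity> M F \<Longrightarrow> v \<in> Lp_sub \<infinity> M F \<Longrightarrow>
      class_add M u v \<in> Lp_sub \<infinity> M F"
proof -
  note ru = rep_Lp[OF u] and rv = rep_Lp[OF v]
  obtain C where C: "AE x in M. norm (rep u x) \<le> C" by (rule rep_Linf_bounded[OF u])
  obtain D where D: "AE x in M. norm (rep v x) \<le> D" by (rule rep_Linf_bounded[OF v])
  have sm: "strongly_measurable M (\<lambda>x. rep u x + rep v x)"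
    by (rule strongly_measurable_add[OF ru(1) rv(1)])
  have bd: "AE x in M. norm (rep u x + rep v x) \<le> C + D"
    using C D by eventually_elim (metis add_mono norm_triangle_ineq order_trans)
  have fin: "Lp_norm \<infinity> M (\<lambda>x. rep u x + rep v x) < \<infinity>"
    using bd Lp_norm_infinity_finite[OF sm] by blast
  show "class_add M u v \<in> Lp \<infinity> M"
    unfolding class_add_def by (rule ae_class_in_Lp[OF sm fin])
  show "class_integral M B (class_add M u v) = class_integral M B u + class_integral M B v"
    if B: "B \<in> sets M" "emeasure M B < \<infinity>"
    unfolding class_add_def class_integral_ae_class[OF B sm bd]
    using strong_integral_add[OF strongly_integrable_indicator[OF B ru(1) C]
        strongly_integrable_indicator[OF B rv(1) D]]
    by (simp add: class_integral_def scaleR_add_right)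
  show "class_add M u v \<in> Lp_sub \<infinity> M F"
    if sub: "subalgebra M F" and uF: "u \<in> Lp_sub \<infinity> M F" and vF: "v \<in> Lp_sub \<infinity> M F"
  proof -
    obtain f where f: "strongly_measurable F f" "AE x in M. rep u x = f x"
      using Lp_subE[OF sub uF] by metis
    obtain g where g: "strongly_measurable F g" "AE x in M. rep v x = g x"
      using Lp_subE[OF sub vF] by metis
    have fg: "strongly_measurable F (\<lambda>x. f x + g x)"
      by (rule strongly_measurable_add[OF f(1) g(1)])
    have eq: "AE x in M. rep u x + rep v x = f x + g x"
      using f(2) g(2) by eventually_elim simp
    have "Lp_norm \<infinity> M (\<lambda>x. f x + g x) < \<infinity>"
      using Lp_norm_cong_AE[OF eq sm strongly_measurable_subalgebra[OF sub fg]] fin by simp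
    then show ?thesis
      unfolding class_add_def ae_class_eqI[OF eq] by (rule Lp_subI[OF sub fg])
  qed
qed

lemma Linf_smul:
  fixes u :: "('a \<Rightarrow> 'y::banach) set"
  assumes smul: "banach_over smul" and u: "u \<in> Lp \<infinity> M"
  shows "class_smul M smul c u \<in> Lp \<infinity> M"
    and "B \<in> sets M \<Longrightarrow> emeasure M B < \<infinity> \<Longrightarrow>
      class_integral M B (class_smul M smul c u) = smul c (class_integral M B u)"
    and "subalgebra M F \<Longrightarrow> u \<in> Lp_sub \<infinity> M F \<Longrightarrow> class_smul M smul c u \<in> Lp_sub \<infinity> M F"
proof -
  note ru = rep_Lp[OF u]
  have lin: "bounded_linear (smul c)" by (rule banach_over_bounded_linear[OF smul])
  interpret L: bounded_linear "smul c" by (rule lin)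
  have cont: "continuous_on UNIV (smul c)" by (rule L.continuous_on[OF continuous_on_id])
  obtain C where C: "AE x in M. norm (rep u x) \<le> C" by (rule rep_Linf_bounded[OF u])
  have sm: "strongly_measurable M (\<lambda>x. smul c (rep u x))"
    by (rule strongly_measurable_compose[OF ru(1) cont])
  have bd: "AE x in M. norm (smul c (rep u x)) \<le> norm c * C"
    using C by eventually_elim (simp add: banach_over.norm_smul[OF smul] mult_left_mono)
  have fin: "Lp_norm \<infinity> M (\<lambda>x. smul c (rep u x)) < \<infinity>"
    using bd Lp_norm_infinity_finite[OF sm] by blast
  show "class_smul M smul c u \<in> Lp \<infinity> M"
    unfolding class_smul_def by (rule ae_class_in_Lp[OF sm fin])
  show "class_integral M B (class_smul M smul c u) = smul c (class_integral M B u)"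
    if B: "B \<in> sets M" "emeasure M B < \<infinity>"
    unfolding class_smul_def class_integral_ae_class[OF B sm bd]
    using strong_integral_bounded_linear[OF lin strongly_integrable_indicator[OF B ru(1) C]]
    by (simp add: class_integral_def L.scaleR)
  show "class_smul M smul c u \<in> Lp_sub \<infinity> M F"
    if sub: "subalgebra M F" and uF: "u \<in> Lp_sub \<infinity> M F"
  proof -
    obtain f where f: "strongly_measurable F f" "AE x in M. rep u x = f x"
      using Lp_subE[OF sub uF] by metis
    have cf: "strongly_measurable F (\<lambda>x. smul c (f x))"
      by (rule strongly_measurable_compose[OF f(1) cont])
    have eq: "AE x in M. smul c (rep u x) = smul c (f x)"
      using f(2) by eventually_elim simp
    have "Lp_norm \<infinity> M (\<lambda>x. smul c (f x)) < \<infinity>"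
      using Lp_norm_cong_AE[OF eq sm strongly_measurable_subalgebra[OF sub cf]] fin by simp
    then show ?thesis
      unfolding class_smul_def ae_class_eqI[OF eq] by (rule Lp_subI[OF sub cf])
  qed
qed

text \<open>The values of \<open>E\<close> are chosen class by class, without regard to the
  operations. Linearity follows from uniqueness: both sides of each law have F-measurable
  representatives and the same integrals over F-sets of finite measure.\<close>

lemma cond_exp_Linf_exists:
  fixes smul :: "'k::{real_normed_field,euclidean_space} \<Rightarrow> 'y::banach \<Rightarrow> 'y"
  assumes sub: "subalgebra M F" and mah: "maharam (restr_to_subalg M F)" and smul: "banach_over smul"
  shows "\<exists>E. cond_exp_Linf M F smul E"
proof -
  have sf: "semi_finite (restr_to_subalg M F)"
    using mah by (simp add: maharam_def)
  have FM: "B \<in> sets M" if "B \<in> sets F" for B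
    using sub that by (auto simp: subalgebra_def)
  have "\<forall>u::('a \<Rightarrow> 'y) set. \<exists>w. u \<in> Lp \<infinity> M \<longrightarrow> w \<in> Lp_sub \<infinity> M F \<and>
      class_norm \<infinity> M w \<le> class_norm \<infinity> M u \<and>
      (\<forall>B\<in>sets F. emeasure M B < \<infinity> \<longrightarrow> class_integral M B u = class_integral M B w)"
    using cond_exp_class_exists[OF sub mah] by metis
  then obtain E :: "('a \<Rightarrow> 'y) set \<Rightarrow> ('a \<Rightarrow> 'y) set" where
    E: "\<And>u. u \<in> Lp \<infinity> M \<Longrightarrow> E u \<in> Lp_sub \<infinity> M F"
      "\<And>u. u \<in> Lp \<infinity> M \<Longrightarrow> class_norm \<infinity> M (E u) \<le> class_norm \<infinity> M u"
      "\<And>u B. u \<in> Lp \<infinity> M \<Longrightarrow> B \<in> sets F \<Longrightarrow> emeasure M B < \<infinity> \<Longrightarrow>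
        class_integral M B u = class_integral M B (E u)"
    by metis
  have E': "E u \<in> Lp \<infinity> M" if "u \<in> Lp \<infinity> M" for u
    using E(1)[OF that] Lp_sub_subset_Lp by blast
  note unique = cond_exp_class_unique[OF sub sf]
  have "bounded_operator \<infinity> M smul E"
    unfolding bounded_operator_def
  proof (intro conjI ballI allI)
    show "E u \<in> Lp \<infinity> M" if "u \<in> Lp \<infinity> M" for u by (rule E'[OF that])
    show "E (class_add M u v) = class_add M (E u) (E v)" if u: "u \<in> Lp \<infinity> M" and v: "v \<in> Lp \<infinity> M" for u v
    proof (rule unique)
      show "E (class_add M u v) \<in> Lp_sub \<infinity> M F" by (intro E Linf_add u v)
      show "class_add M (E u) (E v) \<in> Lp_sub \<infinity> M F" by (intro Linf_add(3) E' E u v sub)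
      show "class_integral M B (E (class_add M u v)) = class_integral M B (class_add M (E u) (E v))"
        if B: "B \<in> sets F" "emeasure M B < \<infinity>" for B
        using E(3)[OF Linf_add(1)[OF u v] B] Linf_add(2)[OF u v FM[OF B(1)] B(2)]
          Linf_add(2)[OF E'[OF u] E'[OF v] FM[OF B(1)] B(2)] E(3)[OF u B] E(3)[OF v B]
        by simp
    qed
    show "E (class_smul M smul c u) = class_smul M smul c (E u)" if u: "u \<in> Lp \<infinity> M" for u c
    proof (rule unique)
      show "E (class_smul M smul c u) \<in> Lp_sub \<infinity> M F" by (intro E Linf_smul smul u)
      show "class_smul M smul c (E u) \<in> Lp_sub \<infinity> M F" by (intro Linf_smul(3) smul E' E u sub)
      show "class_integral M B (E (class_smul M smul c u)) = class_integral M B (class_smul M smul c (E u))"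
        if B: "B \<in> sets F" "emeasure M B < \<infinity>" for B
        using E(3)[OF Linf_smul(1)[OF smul u] B] Linf_smul(2)[OF smul u FM[OF B(1)] B(2)]
          Linf_smul(2)[OF smul E'[OF u] FM[OF B(1)] B(2)] E(3)[OF u B]
        by simp
    qed
    show "\<exists>C. \<forall>u\<in>Lp \<infinity> M. class_norm \<infinity> M (E u) \<le> ennreal C * class_norm \<infinity> M u"
      using E(2) by (intro exI[of _ 1]) simp
  qed
  then have "cond_exp_Linf M F smul E"
    unfolding cond_exp_Linf_def cond_exp_operator_def
    using E unique[OF _ E(1)] by auto
  then show ?thesis by blast
qed

lemma cond_exp_Linf_eqI:
  fixes smul :: "'k::{real_normed_field,euclidean_space} \<Rightarrow> 'y::banach \<Rightarrow> 'y"
  assumes "cond_exp_Linf M F smul E" "u \<in> Lp \<infinity> M" "w \<in> Lp_sub \<infinity> M F"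
    and "\<And>B. B \<in> sets F \<Longrightarrow> emeasure M B < \<infinity> \<Longrightarrow> class_integral M B u = class_integral M B w"
  shows "E u = w"
  using assms unfolding cond_exp_Linf_def cond_exp_operator_def by blast

section \<open>Duality with the conditional expectation on L1\<close>

lemma cond_exp_Linf_dual:
  fixes smulX :: "'k::{real_normed_field,euclidean_space} \<Rightarrow> 'x::banach \<Rightarrow> 'x"
    and smulY :: "'k \<Rightarrow> 'y::banach \<Rightarrow> 'y" and pair :: "'x \<Rightarrow> 'y \<Rightarrow> 'k"
  assumes sub: "subalgebra M F" and pair: "bounded_bilinear pair"
    and E: "cond_exp_Linf M F smulY E" and E1: "cond_exp_L1 M F smulX E1"
    and f: "f \<in> Lp 1 M" and g: "g \<in> Lp \<infinity> M"
  shows "integrable M (\<lambda>x. pair (rep f x) (rep (E g) x))"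
    and "integrable M (\<lambda>x. pair (rep (E1 f) x) (rep g x))"
    and "(LINT x|M. pair (rep f x) (rep (E g) x)) = (LINT x|M. pair (rep (E1 f) x) (rep g x))"
proof -
  have FM: "B \<in> sets M" if "B \<in> sets F" for B
    using sub that by (auto simp: subalgebra_def)
  have Eg: "E g \<in> Lp_sub \<infinity> M F" and Eg_int: "\<And>B. B \<in> sets F \<Longrightarrow> emeasure M B < \<infinity> \<Longrightarrow>
      class_integral M B g = class_integral M B (E g)"
    using E g unfolding cond_exp_Linf_def cond_exp_operator_def by auto
  have E1f: "E1 f \<in> Lp_sub 1 M F" and E1f_int: "\<And>B. B \<in> sets F \<Longrightarrow>
      class_integral M B f = class_integral M B (E1 f)"
    using E1 f unfolding cond_exp_L1_def cond_exp_operator_def by auto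
  obtain v where v: "strongly_measurable F v" "strongly_measurable M v" "AE x in M. rep (E g) x = v x"
    "Lp_norm \<infinity> M v < \<infinity>"
    using Lp_subE[OF sub Eg] by metis
  obtain w where w: "strongly_measurable F w" "strongly_measurable M w" "AE x in M. rep (E1 f) x = w x"
    "Lp_norm 1 M w < \<infinity>"
    using Lp_subE[OF sub E1f] by metis
  note rf = rep_Lp[OF f] and rg = rep_Lp[OF g]
  have rv: "strongly_measurable M (rep (E g))" and rw: "strongly_measurable M (rep (E1 f))"
    using Eg E1f Lp_sub_subset_Lp rep_Lp(1) by blast+
  obtain C where C: "AE x in M. norm (rep g x) \<le> C" by (rule rep_Linf_bounded[OF g])
  obtain D where D: "AE x in M. norm (v x) \<le> D"
    using v Lp_norm_infinity_finite by blast
  have fi: "strongly_integrable M (rep f)" and wi: "strongly_integrable M w"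
    unfolding strongly_integrable_def Lp_norm_1_finite[symmetric] using rf w by blast+
  have ind: "strongly_integrable M (\<lambda>x. indicator B x *\<^sub>R a x)"
    if "B \<in> sets M" "strongly_integrable M a" for B and a :: "'a \<Rightarrow> 'x"
    by (rule strongly_integrable_bound[OF strongly_measurable_indicator_scaleR[OF that(1)
            strongly_integrableD(1)[OF that(2)]] that(2)]) (auto simp: indicator_def)
  have "strongly_integrable M (\<lambda>x. pair (rep f x) (v x)) \<and> strongly_integrable M (\<lambda>x. pair (w x) (v x)) \<and>
    strong_integral M (\<lambda>x. pair (rep f x) (v x)) = strong_integral M (\<lambda>x. pair (w x) (v x))"
  proof -
    \<comment> \<open>The expanded factor is the bounded \<open>v\<close>, whose sets may have
      infinite measure; the L1 identity covers every F-set. As \<open>v\<close> is the second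
      argument of \<open>pair\<close>, the form is flipped below.\<close>
    have eq: "strongly_integrable M (\<lambda>x. indicator B x *\<^sub>R rep f x) \<and>
        strongly_integrable M (\<lambda>x. indicator B x *\<^sub>R w x) \<and>
        strong_integral M (\<lambda>x. indicator B x *\<^sub>R rep f x) = strong_integral M (\<lambda>x. indicator B x *\<^sub>R w x)"
      if B: "B \<in> sets F" for B
      using ind[OF FM[OF B] fi] ind[OF FM[OF B] wi] E1f_int[OF B]
        class_integral_eq[OF FM[OF B] w(2) ind[OF FM[OF B] wi] rw w(3)]
      by (simp add: class_integral_def)
    have fv: "strongly_integrable M (\<lambda>x. norm (v x) * norm (rep f x))"
      using strongly_integrable_norm_mult[OF fi v(2) D] by (simp add: mult.commute)
    have wv: "strongly_integrable M (\<lambda>x. norm (v x) * norm (w x))"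
      using strongly_integrable_norm_mult[OF wi v(2) D] by (simp add: mult.commute)
    show ?thesis
      using strong_integral_bilinear_eq[OF bounded_bilinear.flip[OF pair] sub v(1) rf(1) fv w(2) wv eq]
      by blast
  qed
  moreover have "strongly_integrable M (\<lambda>x. pair (w x) (rep g x)) \<and> strongly_integrable M (\<lambda>x. pair (w x) (v x)) \<and>
    strong_integral M (\<lambda>x. pair (w x) (rep g x)) = strong_integral M (\<lambda>x. pair (w x) (v x))"
  proof -
    have eq: "strongly_integrable M (\<lambda>x. indicator B x *\<^sub>R rep g x) \<and>
        strongly_integrable M (\<lambda>x. indicator B x *\<^sub>R v x) \<and>
        strong_integral M (\<lambda>x. indicator B x *\<^sub>R rep g x) = strong_integral M (\<lambda>x. indicator B x *\<^sub>R v x)"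
      if B: "B \<in> sets F" and ex: "\<exists>c>0. \<forall>x\<in>B. c \<le> norm (w x)" for B
    proof -
      obtain c :: real where c: "0 < c" "\<And>x. x \<in> B \<Longrightarrow> c \<le> norm (w x)"
        using ex by blast
      \<comment> \<open>Markov's inequality: integrability of \<open>w\<close> forces
        \<open>B\<close> to have finite measure, so the identity that defines \<open>E g\<close>
        applies to it.\<close>
      have "ennreal c * emeasure M B = (\<integral>\<^sup>+x. ennreal c * indicator B x \<partial>M)"
        using FM[OF B] by (simp add: nn_integral_cmult_indicator)
      also have "\<dots> \<le> (\<integral>\<^sup>+x. ennreal (norm (w x)) \<partial>M)"
        using c(2) by (intro nn_integral_mono) (auto simp: indicator_def intro: ennreal_leI)
      also have "\<dots> < \<infinity>" by (rule strongly_integrableD(2)[OF wi])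
      finally have fin: "emeasure M B < \<infinity>"
        using c(1) by (auto simp: ennreal_mult_less_top)
      have "class_integral M B (E g) = strong_integral M (\<lambda>x. indicator B x *\<^sub>R v x)"
        by (rule class_integral_eq[OF FM[OF B] v(2) strongly_integrable_indicator[OF FM[OF B] fin v(2) D] rv v(3)])
      then show ?thesis
        using strongly_integrable_indicator[OF FM[OF B] fin rg(1) C]
          strongly_integrable_indicator[OF FM[OF B] fin v(2) D] Eg_int[OF B fin]
        by (simp add: class_integral_def)
    qed
    show ?thesis
      using strong_integral_bilinear_eq[OF pair sub w(1) rg(1) strongly_integrable_norm_mult[OF wi rg(1) C]
          v(2) strongly_integrable_norm_mult[OF wi v(2) D] eq] by blast
  qed
  ultimately have 1: "strongly_integrable M (\<lambda>x. pair (rep f x) (v x))"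
    "strongly_integrable M (\<lambda>x. pair (w x) (rep g x))"
    "strong_integral M (\<lambda>x. pair (rep f x) (v x)) = strong_integral M (\<lambda>x. pair (w x) (rep g x))"
    by auto
  \<comment> \<open>Return from the F-measurable \<open>v\<close> and \<open>w\<close> to the
    representatives in the claim.\<close>
  have 2: "strongly_integrable M (\<lambda>x. pair (rep f x) (rep (E g) x))"
    "strong_integral M (\<lambda>x. pair (rep f x) (v x)) = strong_integral M (\<lambda>x. pair (rep f x) (rep (E g) x))"
    by (rule strong_integral_cong_AE[OF 1(1) strongly_measurable_bilinear[OF pair rf(1) rv]],
        use v(3) in \<open>auto elim!: eventually_mono\<close>)+
  have 3: "strongly_integrable M (\<lambda>x. pair (rep (E1 f) x) (rep g x))"
    "strong_integral M (\<lambda>x. pair (w x) (rep g x)) = strong_integral M (\<lambda>x. pair (rep (E1 f) x) (rep g x))"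
    by (rule strong_integral_cong_AE[OF 1(2) strongly_measurable_bilinear[OF pair rw rg(1)]],
        use w(3) in \<open>auto elim!: eventually_mono\<close>)+
  \<comment> \<open>The pairing takes values in the Euclidean space \<open>'k\<close>, which is
    second countable, so the strong and the Lebesgue integral coincide.\<close>
  show i1: "integrable M (\<lambda>x. pair (rep f x) (rep (E g) x))"
    and i2: "integrable M (\<lambda>x. pair (rep (E1 f) x) (rep g x))"
    using 2(1) 3(1) by (simp_all add: strongly_integrable_iff_integrable)
  show "(LINT x|M. pair (rep f x) (rep (E g) x)) = (LINT x|M. pair (rep (E1 f) x) (rep g x))"
    using 1(3) 2(2) 3(2) strong_integral_eq_lebesgue_integral[OF i1] strong_integral_eq_lebesgue_integral[OF i2]
    by simp
qed

text \<open>The properties are claimed for every \<open>E\<close> with \<open>cond_exp_Linf\<close>,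
  which is possible because the values of such an \<open>E\<close> on
  \<open>Lp \<infinity> M\<close> are determined. Both integrabilities accompany the final equation
  because \<open>LINT\<close> is 0 by default on functions that are not integrable.\<close>

theorem proposition5p2:
  fixes M F :: "'a measure"
    and smulX :: "'k::{real_normed_field,euclidean_space} \<Rightarrow> 'x::banach \<Rightarrow> 'x"
    and smulY :: "'k \<Rightarrow> 'y::banach \<Rightarrow> 'y"
  assumes "semi_finite M"
    and "subalgebra M F"
    and "maharam (restr_to_subalg M F)"
    and "banach_over smulY"
  shows "(\<exists>E. cond_exp_Linf M F smulY E) \<and>
    (\<forall>E. cond_exp_Linf M F smulY E \<longrightarrow>
      (\<forall>u\<in>Lp \<infinity> M. class_norm \<infinity> M (E u) \<le> class_norm \<infinity> M u) \<and>
      (\<forall>u\<in>Lp \<infinity> M. E (E u) = E u) \<and>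
      E ` Lp \<infinity> M = Lp_sub \<infinity> M F \<and>
      (\<forall>pair E1. banach_dual_pair smulX smulY pair \<longrightarrow> cond_exp_L1 M F smulX E1 \<longrightarrow>
        (\<forall>f\<in>Lp 1 M. \<forall>g\<in>Lp \<infinity> M.
          integrable M (\<lambda>x. pair (rep f x) (rep (E g) x)) \<and>
          integrable M (\<lambda>x. pair (rep (E1 f) x) (rep g x)) \<and>
          (LINT x|M. pair (rep f x) (rep (E g) x)) = (LINT x|M. pair (rep (E1 f) x) (rep g x)))))"
proof (intro conjI allI impI)
  show "\<exists>E. cond_exp_Linf M F smulY E"
    by (rule cond_exp_Linf_exists[OF assms(2-4)])
  fix E assume E: "cond_exp_Linf M F smulY E"
  have range: "E u \<in> Lp_sub \<infinity> M F" if "u \<in> Lp \<infinity> M" for u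
    using E that unfolding cond_exp_Linf_def cond_exp_operator_def by blast
  \<comment> \<open>Such a \<open>w\<close> is a candidate for its own conditional expectation.
    Idempotence and surjectivity onto \<open>Lp_sub \<infinity> M F\<close> both follow.\<close>
  have fixed: "E w = w" if "w \<in> Lp_sub \<infinity> M F" for w
    using cond_exp_Linf_eqI[OF E _ that] that Lp_sub_subset_Lp by blast
  show "\<forall>u\<in>Lp \<infinity> M. class_norm \<infinity> M (E u) \<le> class_norm \<infinity> M u"
  proof
    fix u :: "('a \<Rightarrow> 'y) set" assume u: "u \<in> Lp \<infinity> M"
    show "class_norm \<infinity> M (E u) \<le> class_norm \<infinity> M u"
    \<comment> \<open>The given \<open>E\<close> is arbitrary, so its value is identified with the
      class constructed earlier, for which the norm bound is known.\<close>
    proof (rule cond_exp_class_exists[OF assms(2,3) u])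
      fix w assume w: "w \<in> Lp_sub \<infinity> M F" "class_norm \<infinity> M w \<le> class_norm \<infinity> M u"
        "\<And>B. B \<in> sets F \<Longrightarrow> emeasure M B < \<infinity> \<Longrightarrow> class_integral M B u = class_integral M B w"
      show ?thesis
        using cond_exp_Linf_eqI[OF E u w(1,3)] w(2) by simp
    qed
  qed
  show "\<forall>u\<in>Lp \<infinity> M. E (E u) = E u"
    using range fixed by blast
  show "E ` Lp \<infinity> M = Lp_sub \<infinity> M F"
  proof
    show "E ` Lp \<infinity> M \<subseteq> Lp_sub \<infinity> M F" using range by blast
    show "Lp_sub \<infinity> M F \<subseteq> E ` Lp \<infinity> M"
    proof
      fix w :: "('a \<Rightarrow> 'y) set" assume "w \<in> Lp_sub \<infinity> M F"
      then show "w \<in> E ` Lp \<infinity> M"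
        using fixed[of w] Lp_sub_subset_Lp by (metis image_eqI subsetD)
    qed
  qed
  fix pair E1
  assume "banach_dual_pair smulX smulY pair" and E1: "cond_exp_L1 M F smulX E1"
  then have pair: "bounded_bilinear pair" by (simp add: banach_dual_pair_def)
  show "\<forall>f\<in>Lp 1 M. \<forall>g\<in>Lp \<infinity> M.
      integrable M (\<lambda>x. pair (rep f x) (rep (E g) x)) \<and>
      integrable M (\<lambda>x. pair (rep (E1 f) x) (rep g x)) \<and>
      (LINT x|M. pair (rep f x) (rep (E g) x)) = (LINT x|M. pair (rep (E1 f) x) (rep g x))"
    using cond_exp_Linf_dual[OF assms(2) pair E E1] by blast
qed

end
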